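(* Let $f:M\to(N,g)$ be a pluri-harmonic map from a compact complex manifold $M$ to a compact Kähler manifold $(N,g)$. If $(N,g)$ has strongly negative curvature (in the sense of Siu) and $\operatorname{rank}_{\mathbb R}df\ge 4$, then $f$ is holomorphic or anti-holomorphic.
   Context: Manifolds are connected and maps are smooth. $\operatorname{rank}_{\mathbb R}df$ denotes the maximum over $M$ of the real rank of $df$; thus $\operatorname{rank}_{\mathbb R}df\ge4$ means the rank is at least $4$ at some point. A smooth map $f:M\to(N,g)$ from a complex manifold to a Kähler manifold is pluri-harmonic if, in local holomorphic coordinates $z^\alpha$ on $M$ and $w^i$ on $N$, for all $\alpha,\beta,i$, $$\frac{\partial^2 f^i}{\partial z^\alpha\partial\bar z^\beta}+\Gamma^i_{jk}(f)\frac{\partial f^j}{\partial\bar z^\beta}\frac{\partial f^k}{\partial z^\alpha}=0,$$ where $\Gamma^i_{jk}=g^{i\bar\ell}\partial g_{k\bar\ell}/\partial w^j$ are the Christoffel symbols of the Kähler metric $g$. Curvature components of $(N,g)$, $n=\dim_{\mathbb C}N$: $R_{i\bar jk\bar\ell}=-\frac{\partial^2g_{k\bar\ell}}{\partial w^i\partial\bar w^j}+g^{p\bar q}\frac{\partial g_{k\bar q}}{\partial w^i}\frac{\partial g_{p\bar\ell}}{\partial\bar w^j}$. The curvature is strongly negative if at every point of $N$ $$\sum_{i,j,k,\ell}R_{i\bar jk\bar\ell}\,(A^i\overline{B}^{j}-C^i\overline{D}^{j})\,\overline{(A^\ell\overline{B}^{k}-C^\ell\overline{D}^{k})}<0$$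 for all $A,B,C,D\in\mathbb C^n$ such that the matrix $(A^i\overline{B}^{j}-C^i\overline{D}^{j})_{i,j}$ is nonzero. *)

theory Defs
  imports "HOL-Analysis.Analysis"
begin

section \<open>Calculus on open subsets of complex coordinate space\<close>

text \<open>All derivatives below are real Frechet derivatives; they are only used at interior points
  of the set on which the function is of interest.\<close>

primrec Ck_on :: "nat \<Rightarrow> ('a::euclidean_space \<Rightarrow> 'b::real_normed_vector) \<Rightarrow> 'a set \<Rightarrow> bool" where
  "Ck_on 0 f S \<longleftrightarrow> continuous_on S f"
| "Ck_on (Suc k) f S \<longleftrightarrow>
     (\<forall>x\<in>S. f differentiable (at x)) \<and> (\<forall>v. Ck_on k (\<lambda>x. frechet_derivative f (at x) v) S)"

definition smooth_on :: "('a::euclidean_space \<Rightarrow> 'b::real_normed_vector) \<Rightarrow> 'a set \<Rightarrow> bool" where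
  "smooth_on f S \<longleftrightarrow> (\<forall>k. Ck_on k f S)"

definition hol_on :: "(complex^'m \<Rightarrow> complex^'n) \<Rightarrow> (complex^'m) set \<Rightarrow> bool" where
  "hol_on F S \<longleftrightarrow>
     (\<forall>z\<in>S. \<exists>D. (F has_derivative D) (at z) \<and> (\<forall>c v. D (c *s v) = c *s D v))"

definition antihol_on :: "(complex^'m \<Rightarrow> complex^'n) \<Rightarrow> (complex^'m) set \<Rightarrow> bool" where
  "antihol_on F S \<longleftrightarrow>
     (\<forall>z\<in>S. \<exists>D. (F has_derivative D) (at z) \<and> (\<forall>c v. D (c *s v) = cnj c *s D v))"

text \<open>The Wirtinger operators: with \<open>z\<^sup>\<alpha> = x\<^sup>\<alpha> + \<i> y\<^sup>\<alpha>\<close>, the real directions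
  \<open>axis \<alpha> 1\<close> and \<open>axis \<alpha> \<i>\<close> are those of \<open>x\<^sup>\<alpha>\<close> and \<open>y\<^sup>\<alpha>\<close>.\<close>

definition dz :: "'m \<Rightarrow> (complex^'m \<Rightarrow> complex) \<Rightarrow> complex^'m \<Rightarrow> complex" where
  "dz \<alpha> u z = (frechet_derivative u (at z) (axis \<alpha> 1)
                - \<i> * frechet_derivative u (at z) (axis \<alpha> \<i>)) / 2"

definition dzbar :: "'m \<Rightarrow> (complex^'m \<Rightarrow> complex) \<Rightarrow> complex^'m \<Rightarrow> complex" where
  "dzbar \<alpha> u z = (frechet_derivative u (at z) (axis \<alpha> 1)
                + \<i> * frechet_derivative u (at z) (axis \<alpha> \<i>)) / 2"


section \<open>Complex manifolds\<close>

text \<open>A chart is a pair of a domain and a coordinate map; values of the coordinate map outside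
  the domain are irrelevant. A manifold is a (Hausdorff, second countable) type together with
  a holomorphic atlas, which need not be maximal: all notions below are invariant under
  holomorphic changes of coordinates.\<close>

type_synonym ('a, 'n) chart = "'a set \<times> ('a \<Rightarrow> complex^'n)"

abbreviation cdom :: "('a, 'n::finite) chart \<Rightarrow> 'a set" where
  "cdom c \<equiv> fst c"

abbreviation coord :: "('a, 'n::finite) chart \<Rightarrow> 'a \<Rightarrow> complex^'n" where
  "coord c \<equiv> snd c"

definition param :: "('a, 'n::finite) chart \<Rightarrow> complex^'n \<Rightarrow> 'a" where
  "param c = inv_into (cdom c) (coord c)"

definition is_chart :: "('a::topological_space, 'n::finite) chart \<Rightarrow> bool" where
  "is_chart c \<longleftrightarrow> open (cdom c) \<and> open (coord c ` cdom c)
     \<and> homeomorphism (cdom c) (coord c ` cdom c) (coord c) (param c)"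

definition transition :: "('a, 'n::finite) chart \<Rightarrow> ('a, 'n::finite) chart \<Rightarrow> complex^'n \<Rightarrow> complex^'n" where
  "transition c d = (\<lambda>z. coord d (param c z))"

definition complex_manifold ::
    "('a::{t2_space,second_countable_topology}, 'n::finite) chart set \<Rightarrow> bool" where
  "complex_manifold \<A> \<longleftrightarrow> connected (UNIV :: 'a set)
     \<and> (\<forall>c\<in>\<A>. is_chart c) \<and> (\<Union>c\<in>\<A>. cdom c) = UNIV
     \<and> (\<forall>c\<in>\<A>. \<forall>d\<in>\<A>. hol_on (transition c d) (coord c ` (cdom c \<inter> cdom d)))"


section \<open>Maps between complex manifolds\<close>

definition local_rep ::
    "('a, 'm::finite) chart \<Rightarrow> ('b, 'n::finite) chart \<Rightarrow> ('a \<Rightarrow> 'b) \<Rightarrow> complex^'m \<Rightarrow> complex^'n" where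
  "local_rep c d f = (\<lambda>z. coord d (f (param c z)))"

definition local_dom ::
    "('a, 'm::finite) chart \<Rightarrow> ('b, 'n::finite) chart \<Rightarrow> ('a \<Rightarrow> 'b) \<Rightarrow> (complex^'m) set" where
  "local_dom c d f = coord c ` (cdom c \<inter> f -` cdom d)"

definition smooth_map ::
    "('a::topological_space, 'm::finite) chart set \<Rightarrow> ('b::topological_space, 'n::finite) chart set
      \<Rightarrow> ('a \<Rightarrow> 'b) \<Rightarrow> bool" where
  "smooth_map \<A> \<B> f \<longleftrightarrow> continuous_on UNIV f
     \<and> (\<forall>c\<in>\<A>. \<forall>d\<in>\<B>. smooth_on (local_rep c d f) (local_dom c d f))"

definition holomorphic_map ::
    "('a::topological_space, 'm::finite) chart set \<Rightarrow> ('b::topological_space, 'n::finite) chart set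
      \<Rightarrow> ('a \<Rightarrow> 'b) \<Rightarrow> bool" where
  "holomorphic_map \<A> \<B> f \<longleftrightarrow> continuous_on UNIV f
     \<and> (\<forall>c\<in>\<A>. \<forall>d\<in>\<B>. hol_on (local_rep c d f) (local_dom c d f))"

definition antiholomorphic_map ::
    "('a::topological_space, 'm::finite) chart set \<Rightarrow> ('b::topological_space, 'n::finite) chart set
      \<Rightarrow> ('a \<Rightarrow> 'b) \<Rightarrow> bool" where
  "antiholomorphic_map \<A> \<B> f \<longleftrightarrow> continuous_on UNIV f
     \<and> (\<forall>c\<in>\<A>. \<forall>d\<in>\<B>. antihol_on (local_rep c d f) (local_dom c d f))"

text \<open>\<open>dim\<close> is the dimension over the reals. The set is nonempty and bounded by the real
  dimensions of the manifolds; the rank at a point does not depend on the charts around it.\<close>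

definition max_real_rank ::
    "('a, 'm::finite) chart set \<Rightarrow> ('b, 'n::finite) chart set \<Rightarrow> ('a \<Rightarrow> 'b) \<Rightarrow> nat" where
  "max_real_rank \<A> \<B> f =
     Max {dim (range (frechet_derivative (local_rep c d f) (at z))) | c d z.
            c \<in> \<A> \<and> d \<in> \<B> \<and> z \<in> local_dom c d f}"


section \<open>Kaehler metrics and their curvature\<close>

text \<open>A metric is given by its component matrices: \<open>g d w $ i $ j\<close> is the component
  \<open>g\<^bsub>i j-bar\<^esub>\<close> in the chart \<open>d\<close> at the point with coordinates \<open>w\<close>.\<close>

type_synonym ('b, 'n) metric = "('b, 'n) chart \<Rightarrow> complex^'n \<Rightarrow> complex^'n^'n"

definition herm :: "complex^'n^'n \<Rightarrow> complex^'n \<Rightarrow> complex^'n \<Rightarrow> complex" where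
  "herm G u v = (\<Sum>i\<in>UNIV. \<Sum>j\<in>UNIV. G $ i $ j * u $ i * cnj (v $ j))"

definition hermitian_metric :: "('b, 'n::finite) chart set \<Rightarrow> ('b, 'n::finite) metric \<Rightarrow> bool" where
  "hermitian_metric \<B> g \<longleftrightarrow>
     (\<forall>d\<in>\<B>. smooth_on (g d) (coord d ` cdom d)
        \<and> (\<forall>w\<in>coord d ` cdom d.
             (\<forall>i j. g d w $ j $ i = cnj (g d w $ i $ j))
             \<and> (\<forall>v. v \<noteq> 0 \<longrightarrow> Re (herm (g d w) v v) > 0)))
     \<and> (\<forall>d\<in>\<B>. \<forall>e\<in>\<B>. \<forall>w\<in>coord d ` (cdom d \<inter> cdom e). \<forall>i j.
          g d w $ i $ j =
            (\<Sum>k\<in>UNIV. \<Sum>l\<in>UNIV. g e (transition d e w) $ k $ l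
               * dz i (\<lambda>x. transition d e x $ k) w * cnj (dz j (\<lambda>x. transition d e x $ l) w)))"

text \<open>The fundamental form \<open>\<omega> = \<i> g\<^bsub>i j-bar\<^esub> dw\<^sup>i \<and> dw-bar\<^sup>j\<close>, evaluated on real
  tangent vectors, is \<open>\<i> (h(u,v) - h(v,u)) = -2 Im h(u,v)\<close> for the Hermitian form \<open>h\<close>.
  The exterior derivative is evaluated on constant vector fields.\<close>

definition fundamental_form ::
    "('b, 'n::finite) metric \<Rightarrow> ('b, 'n::finite) chart \<Rightarrow> complex^'n \<Rightarrow> complex^'n \<Rightarrow> complex^'n \<Rightarrow> real" where
  "fundamental_form g d w u v = - 2 * Im (herm (g d w) u v)"

definition kaehler_metric :: "('b, 'n::finite) chart set \<Rightarrow> ('b, 'n::finite) metric \<Rightarrow> bool" where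
  "kaehler_metric \<B> g \<longleftrightarrow> hermitian_metric \<B> g
     \<and> (\<forall>d\<in>\<B>. \<forall>w\<in>coord d ` cdom d. \<forall>u v x.
          frechet_derivative (\<lambda>y. fundamental_form g d y v x) (at w) u
          - frechet_derivative (\<lambda>y. fundamental_form g d y u x) (at w) v
          + frechet_derivative (\<lambda>y. fundamental_form g d y u v) (at w) x = 0)"

text \<open>The inverse components satisfy
  \<open>g\<^sup>i\<^sup>l g\<^sub>k\<^sub>l = \<delta>\<^sup>i\<^sub>k\<close> (summed over \<open>l\<close>, the barred index), hence the transpose.\<close>

definition ginv :: "('b, 'n::finite) metric \<Rightarrow> ('b, 'n::finite) chart \<Rightarrow> complex^'n \<Rightarrow> complex^'n^'n" where
  "ginv g d w = matrix_inv (transpose (g d w))"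

definition christoffel ::
    "('b, 'n::finite) metric \<Rightarrow> ('b, 'n::finite) chart \<Rightarrow> complex^'n \<Rightarrow> 'n \<Rightarrow> 'n \<Rightarrow> 'n \<Rightarrow> complex" where
  "christoffel g d w i j k =
     (\<Sum>l\<in>UNIV. ginv g d w $ i $ l * dz j (\<lambda>y. g d y $ k $ l) w)"

definition curvature ::
    "('b, 'n::finite) metric \<Rightarrow> ('b, 'n::finite) chart \<Rightarrow> complex^'n \<Rightarrow> 'n \<Rightarrow> 'n \<Rightarrow> 'n \<Rightarrow> 'n \<Rightarrow> complex" where
  "curvature g d w i j k l =
     - dz i (dzbar j (\<lambda>y. g d y $ k $ l)) w
     + (\<Sum>p\<in>UNIV. \<Sum>q\<in>UNIV. ginv g d w $ p $ q
          * dz i (\<lambda>y. g d y $ k $ q) w * dzbar j (\<lambda>y. g d y $ p $ l) w)"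

definition siu_matrix ::
    "complex^'n \<Rightarrow> complex^'n \<Rightarrow> complex^'n \<Rightarrow> complex^'n \<Rightarrow> complex^'n^'n" where
  "siu_matrix A B C D = (\<chi> i j. A $ i * cnj (B $ j) - C $ i * cnj (D $ j))"

text \<open>The sum is real for a Kaehler metric, by the symmetries of the curvature tensor.\<close>

definition strongly_negative_curvature :: "('b, 'n::finite) chart set \<Rightarrow> ('b, 'n::finite) metric \<Rightarrow> bool" where
  "strongly_negative_curvature \<B> g \<longleftrightarrow>
     (\<forall>d\<in>\<B>. \<forall>w\<in>coord d ` cdom d. \<forall>A B C D. siu_matrix A B C D \<noteq> 0 \<longrightarrow>
        Re (\<Sum>i\<in>UNIV. \<Sum>j\<in>UNIV. \<Sum>k\<in>UNIV. \<Sum>l\<in>UNIV.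
              curvature g d w i j k l
              * siu_matrix A B C D $ i $ j * cnj (siu_matrix A B C D $ l $ k)) < 0)"


section \<open>Pluri-harmonic maps\<close>

definition pluriharmonic_map ::
    "('a::topological_space, 'm::finite) chart set \<Rightarrow> ('b::topological_space, 'n::finite) chart set
      \<Rightarrow> ('b, 'n::finite) metric \<Rightarrow> ('a \<Rightarrow> 'b) \<Rightarrow> bool" where
  "pluriharmonic_map \<A> \<B> g f \<longleftrightarrow> smooth_map \<A> \<B> f
     \<and> (\<forall>c\<in>\<A>. \<forall>d\<in>\<B>. \<forall>z\<in>local_dom c d f. \<forall>\<alpha> \<beta> i.
          dz \<alpha> (dzbar \<beta> (\<lambda>x. local_rep c d f x $ i)) z
          + (\<Sum>j\<in>UNIV. \<Sum>k\<in>UNIV. christoffel g d (local_rep c d f z) i j k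
               * dzbar \<beta> (\<lambda>x. local_rep c d f x $ j) z
               * dz \<alpha> (\<lambda>x. local_rep c d f x $ k) z) = 0)"

end

theory Submission
  imports Defs
begin

text \<open>Write \<open>A\<^sub>\<alpha> = \<partial>\<^sub>\<alpha> f\<close> and \<open>B\<^sub>\<beta> = \<partial>\<^bsub>\<beta>-bar\<^esub> f\<close> for the (1,0)-components of the
  differential. Pluri-harmonicity says \<open>\<nabla>\<^bsub>\<beta>-bar\<^esub> A\<^sub>\<gamma> = 0\<close>, so the (0,2)-part of the pulled back
  curvature annihilates every \<open>A\<^sub>\<gamma>\<close>. Paired with the \<open>B\<^sub>\<delta>\<close> this is the vanishing of Siu's
  curvature expression, whence \<open>B\<^sub>\<alpha> \<otimes> cnj A\<^sub>\<beta> = B\<^sub>\<beta> \<otimes> cnj A\<^sub>\<alpha>\<close> by strong negativity, and no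
  Bochner formula is needed. If the rank is at least 3 at a point, this relation
  forces \<open>B = 0\<close> or \<open>A = 0\<close> nearby. Both \<open>A\<close> and \<open>cnj B\<close> satisfy linear systems
  \<open>\<partial>-bar u = M u\<close>, so the vanishing propagates over the connected manifold by unique continuation,
  which follows from an almost-monotone frequency function on concentric circles.\<close>

section \<open>Calculus of continuously differentiable functions\<close>

text \<open>Unique continuation is needed because the tensor relation alone decides nothing at
  points of low rank: \<open>A = t \<otimes> p\<close>, \<open>B = cnj t \<otimes> q\<close>
  satisfies it with both factors nonzero. The dichotomy is therefore won only near one point and has
  to be carried through the degenerate set. The coefficients of the linear systems are merely
  continuous functions of the point, so power series are out of reach; all that is used is an
  inequality \<open>|dbar u| \<le> K |u|\<close>. Restriction to complex lines through the centre of
  a ball reduces it to one variable, and \<open>z = exp (s + i t)\<close> turns it into an evolution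
  in \<open>s\<close> with an operator that is symmetric over each circle, the setting of
  logarithmic convexity. On the curvature side the index is lowered before differentiating: the
  Christoffel symbols contain the inverse metric, whereas the lowered equation contains only
  \<open>g\<close> and its first derivatives. The inverse metric then enters only through its
  values, as in the definition of the curvature.\<close>

lemma Ck_on_cong:
  assumes "open S" "\<And>x. x \<in> S \<Longrightarrow> f x = g x" "Ck_on k f S"
  shows "Ck_on k g S"
  using assms(2,3)
proof (induction k arbitrary: f g)
  case 0
  then show ?case by (metis Ck_on.simps(1) continuous_on_cong)
next
  case (Suc k)
  have eq: "frechet_derivative f (at x) = frechet_derivative g (at x)" if "x \<in> S" for x
    using frechet_derivative_transform_within_open[of f x S g] Suc.prems assms(1) that by auto
  have "g differentiable (at x)" if "x \<in> S" for x
  proof -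
    from that Suc.prems obtain D where D: "(f has_derivative D) (at x)"
      by (auto simp: differentiable_def)
    then have "(g has_derivative D) (at x)"
      by (rule has_derivative_transform_within_open[OF _ assms(1) that]) (use Suc.prems in auto)
    then show ?thesis
      by (auto simp: differentiable_def)
  qed
  moreover have "Ck_on k (\<lambda>x. frechet_derivative g (at x) v) S" for v
    by (rule Suc.IH[of "\<lambda>x. frechet_derivative f (at x) v"]) (use Suc.prems eq in auto)
  ultimately show ?case by simp
qed

lemma Ck_on_subset: "Ck_on k f S \<Longrightarrow> T \<subseteq> S \<Longrightarrow> Ck_on k f T"
  by (induction k arbitrary: f) (auto intro: continuous_on_subset)

lemma Ck_on_imp_continuous_on: "Ck_on k f S \<Longrightarrow> continuous_on S f"
proof (cases k)
  case (Suc n)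
  assume "Ck_on k f S"
  then show ?thesis
    using Suc by (auto intro!: differentiable_imp_continuous_on
        simp: differentiable_on_def differentiable_at_withinI)
qed auto

text \<open>The induction closes because the directional derivative of \<open>L o f\<close> is
  \<open>L\<close> applied to that of \<open>f\<close>. This formula holds on \<open>S\<close> only,
  hence the transfer by \<open>Ck_on_cong\<close>; the next closure rules follow the same
  pattern.\<close>

lemma Ck_on_bounded_linear:
  assumes "open S" "bounded_linear L" "Ck_on k f S"
  shows "Ck_on k (\<lambda>x. L (f x)) S"
  using assms(3)
proof (induction k arbitrary: f)
  case 0
  then show ?case using assms(2)
    by (auto intro: bounded_linear.continuous_on)
next
  case (Suc k)
  have D: "((\<lambda>x. L (f x)) has_derivative (\<lambda>v. L (frechet_derivative f (at x) v))) (at x)"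
    if "x \<in> S" for x
    using Suc.prems that
    by (intro bounded_linear.has_derivative[OF assms(2)]) (simp add: frechet_derivative_works[symmetric])
  have "Ck_on k (\<lambda>x. frechet_derivative (\<lambda>x. L (f x)) (at x) v) S" for v
  proof (rule Ck_on_cong[OF assms(1)])
    show "Ck_on k (\<lambda>x. L (frechet_derivative f (at x) v)) S"
      using Suc by auto
  qed (simp add: frechet_derivative_at[OF D, symmetric])
  with D show ?case by (auto simp: differentiable_def)
qed

lemma Ck_on_add:
  assumes "open S" "Ck_on k f S" "Ck_on k g S"
  shows "Ck_on k (\<lambda>x. f x + g x) S"
  using assms(2,3)
proof (induction k arbitrary: f g)
  case 0
  then show ?case by (auto intro: continuous_intros)
next
  case (Suc k)
  have D: "((\<lambda>x. f x + g x) has_derivative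
      (\<lambda>v. frechet_derivative f (at x) v + frechet_derivative g (at x) v)) (at x)"
    if "x \<in> S" for x
    using Suc.prems that by (auto intro!: derivative_intros simp: frechet_derivative_works[symmetric])
  have "Ck_on k (\<lambda>x. frechet_derivative (\<lambda>x. f x + g x) (at x) v) S" for v
  proof (rule Ck_on_cong[OF assms(1)])
    show "Ck_on k (\<lambda>x. frechet_derivative f (at x) v + frechet_derivative g (at x) v) S"
      using Suc by auto
  qed (simp add: frechet_derivative_at[OF D, symmetric])
  with D show ?case by (auto simp: differentiable_def)
qed

text \<open>An affine inner map has the constant derivative \<open>L\<close>, so directional
  derivatives of the composite are again composites with the same map and no product terms arise.
  The lemma serves to restrict a map to a complex line.\<close>

lemma Ck_on_compose_affine:
  assumes "open S" "open T" "bounded_linear L" "\<And>x. x \<in> T \<Longrightarrow> p + L x \<in> S" "Ck_on k f S"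
  shows "Ck_on k (\<lambda>x. f (p + L x)) T"
  using assms(5)
proof (induction k arbitrary: f)
  case 0
  have "continuous_on T (\<lambda>x. p + L x)"
    using assms(3) by (intro continuous_intros linear_continuous_on)
  then show ?case using 0 assms(4)
    by (auto intro: continuous_on_compose2)
next
  case (Suc k)
  have D: "((\<lambda>x. f (p + L x)) has_derivative (\<lambda>v. frechet_derivative f (at (p + L x)) (L v))) (at x)"
    if "x \<in> T" for x
  proof (rule has_derivative_compose[where f = "\<lambda>x. p + L x" and g = f])
    show "((\<lambda>x. p + L x) has_derivative L) (at x)"
      using assms(3) by (auto intro!: derivative_eq_intros bounded_linear_imp_has_derivative)
    show "(f has_derivative frechet_derivative f (at (p + L x))) (at (p + L x))"
      using Suc.prems assms(4)[OF that] by (auto simp: frechet_derivative_works[symmetric])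
  qed
  have "Ck_on k (\<lambda>x. frechet_derivative (\<lambda>x. f (p + L x)) (at x) v) T" for v
  proof (rule Ck_on_cong[OF assms(2)])
    show "Ck_on k (\<lambda>x. frechet_derivative f (at (p + L x)) (L v)) T"
      using Suc.prems by (intro Suc.IH) auto
  qed (simp add: frechet_derivative_at[OF D, symmetric])
  with D show ?case by (auto simp: differentiable_def)
qed

lemma Ck_on_has_derivative:
  assumes "Ck_on (Suc k) f S" "x \<in> S"
  shows "(f has_derivative frechet_derivative f (at x)) (at x)"
  using assms by (auto simp: frechet_derivative_works[symmetric])

lemma Ck_on_along_line:
  fixes x v :: "'a::euclidean_space"
  assumes "Ck_on (Suc k) u S" "x + s *\<^sub>R v \<in> S"
  shows "((\<lambda>t. u (x + t *\<^sub>R v)) has_vector_derivative frechet_derivative u (at (x + s *\<^sub>R v)) v) (at s within I)"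
proof -
  have lin: "linear (frechet_derivative u (at (x + s *\<^sub>R v)))"
    using assms by (auto intro: linear_frechet_derivative)
  have "((\<lambda>t. u (x + t *\<^sub>R v)) has_derivative
      (\<lambda>t. frechet_derivative u (at (x + s *\<^sub>R v)) (t *\<^sub>R v))) (at s within I)"
  proof (rule has_derivative_compose[where f = "\<lambda>t. x + t *\<^sub>R v" and g = u])
    show "((\<lambda>t. x + t *\<^sub>R v) has_derivative (\<lambda>t. t *\<^sub>R v)) (at s within I)"
      by (auto intro!: derivative_eq_intros)
  qed (rule Ck_on_has_derivative[OF assms])
  then show ?thesis
    by (simp add: has_vector_derivative_def linear_scale[OF lin])
qed

text \<open>Write \<open>u (x + s v + t w) - u (x + s v)\<close> as the integral of the
  \<open>w\<close>-derivative along the segment, differentiate in \<open>s\<close> under the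
  integral sign, and then differentiate the result in \<open>t\<close>.\<close>

lemma frechet_derivative_commute:
  fixes u :: "'a::euclidean_space \<Rightarrow> 'b::banach"
  assumes C: "Ck_on 2 u S" and S: "open S" "x \<in> S"
  shows "frechet_derivative (\<lambda>y. frechet_derivative u (at y) v) (at x) w
       = frechet_derivative (\<lambda>y. frechet_derivative u (at y) w) (at x) v"
proof -
  define d where "d w y = frechet_derivative u (at y) w" for w y
  define dd where "dd w v y = frechet_derivative (d w) (at y) v" for w v y
  have C': "Ck_on (Suc (Suc 0)) u S" "\<And>w. Ck_on (Suc 0) (d w) S" "\<And>v w. Ck_on 0 (dd v w) S"
    using C unfolding d_def dd_def by (simp_all add: numeral_2_eq_2)
  obtain r where r: "r > 0" "ball x r \<subseteq> S"
    using S openE by blast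
  \<comment> \<open>Keeps the parallelogram of all \<open>x + s v + t w\<close> with
    \<open>|s|, |t| \<le> e\<close> inside the ball; the summand 1 covers
    \<open>v = w = 0\<close>.\<close>
  define e where "e = r / (2 * (norm v + norm w + 1))"
  have e: "e > 0" using r(1) by (auto simp: e_def intro!: divide_pos_pos add_nonneg_pos)
  have inS: "x + s *\<^sub>R v + t *\<^sub>R w \<in> S" if "\<bar>s\<bar> \<le> e" "\<bar>t\<bar> \<le> e" for s t
  proof -
    have "norm (s *\<^sub>R v + t *\<^sub>R w) \<le> \<bar>s\<bar> * norm v + \<bar>t\<bar> * norm w"
      using norm_triangle_ineq[of "s *\<^sub>R v" "t *\<^sub>R w"] by simp
    also have "\<dots> \<le> e * norm v + e * norm w"
      using that by (intro add_mono mult_right_mono) auto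
    also have "\<dots> < r"
    proof -
      have "e * (2 * (norm v + norm w + 1)) = r"
        unfolding e_def using add_nonneg_pos[of "norm v + norm w" 1] by (simp add: divide_simps)
      moreover have "e * norm v \<ge> 0" "e * norm w \<ge> 0" using e by auto
      ultimately show ?thesis using e unfolding distrib_left by linarith
    qed
    finally have "norm (s *\<^sub>R v + t *\<^sub>R w) < r" .
    then have "x + s *\<^sub>R v + t *\<^sub>R w \<in> ball x r"
      by (simp add: dist_norm norm_minus_commute add.assoc add.commute)
    then show ?thesis using r by blast
  qed
  have sw: "x + s *\<^sub>R v + t *\<^sub>R w = (x + t *\<^sub>R w) + s *\<^sub>R v" for s t by simp
  have int1: "((\<lambda>\<tau>. d w (x + s *\<^sub>R v + \<tau> *\<^sub>R w)) has_integral
      u (x + s *\<^sub>R v + t *\<^sub>R w) - u (x + s *\<^sub>R v)) {0..t}" if "\<bar>s\<bar> \<le> e" "0 \<le> t" "t \<le> e" for s t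
  proof -
    have "((\<lambda>\<tau>. d w (x + s *\<^sub>R v + \<tau> *\<^sub>R w)) has_integral
      u (x + s *\<^sub>R v + t *\<^sub>R w) - u (x + s *\<^sub>R v + 0 *\<^sub>R w)) {0..t}"
      unfolding d_def
      by (rule fundamental_theorem_of_calculus)
         (use that in \<open>auto intro!: Ck_on_along_line[OF C'(1)] inS\<close>)
    then show ?thesis by simp
  qed
  have cdd: "continuous_on A (\<lambda>y. dd w v (h y))"
    if "continuous_on A h" "\<And>y. y \<in> A \<Longrightarrow> h y \<in> S" for h :: "'c::topological_space \<Rightarrow> 'a" and A
    using C'(3)[of w v] that by (auto intro: continuous_on_compose2)
  \<comment> \<open>The \<open>s\<close>-derivative at 0 of the identity \<open>int1\<close>,
    computed once under the integral and once directly.\<close>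
  have key: "d v (x + t *\<^sub>R w) = d v x + integral {0..t} (\<lambda>\<tau>. dd w v (x + \<tau> *\<^sub>R w))"
    if t: "0 \<le> t" "t \<le> e" for t
  proof -
    have "((\<lambda>s. integral (cbox 0 t) (\<lambda>\<tau>. d w (x + s *\<^sub>R v + \<tau> *\<^sub>R w))) has_vector_derivative
       integral (cbox 0 t) (\<lambda>\<tau>. dd w v (x + 0 *\<^sub>R v + \<tau> *\<^sub>R w))) (at 0 within {-e..e})"
    proof (rule leibniz_rule_vector_derivative)
      fix s \<tau> assume A: "s \<in> {-e..e}" "\<tau> \<in> cbox 0 t"
      show "((\<lambda>s. d w (x + s *\<^sub>R v + \<tau> *\<^sub>R w)) has_vector_derivative dd w v (x + s *\<^sub>R v + \<tau> *\<^sub>R w)) (at s within {-e..e})"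
        unfolding sw dd_def
        by (rule Ck_on_along_line[OF C'(2)]) (use A t inS[of s \<tau>] sw in auto)
    next
      fix s assume "s \<in> {-e..e}"
      then show "(\<lambda>\<tau>. d w (x + s *\<^sub>R v + \<tau> *\<^sub>R w)) integrable_on cbox 0 t"
        using has_integral_integrable[OF int1[of s t]] t by auto
    next
      show "continuous_on ({-e..e} \<times> cbox 0 t) (\<lambda>(s, \<tau>). dd w v (x + s *\<^sub>R v + \<tau> *\<^sub>R w))"
        unfolding split_beta by (rule cdd) (use t in \<open>auto intro!: continuous_intros inS\<close>)
    qed (use e in auto)
    then have 1: "((\<lambda>s. integral (cbox 0 t) (\<lambda>\<tau>. d w (x + s *\<^sub>R v + \<tau> *\<^sub>R w))) has_vector_derivative
       integral (cbox 0 t) (\<lambda>\<tau>. dd w v (x + \<tau> *\<^sub>R w))) (at 0 within {-e..e})"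
      by simp
    have "((\<lambda>s. u (x + t *\<^sub>R w + s *\<^sub>R v) - u (x + s *\<^sub>R v)) has_vector_derivative d v (x + t *\<^sub>R w + 0 *\<^sub>R v) - d v (x + 0 *\<^sub>R v)) (at 0 within {-e..e})"
      unfolding d_def
      by (intro derivative_intros Ck_on_along_line[OF C'(1)])
         (use inS[of 0 t] t e S(2) in auto)
    then have 2: "((\<lambda>s. integral (cbox 0 t) (\<lambda>\<tau>. d w (x + s *\<^sub>R v + \<tau> *\<^sub>R w))) has_vector_derivative
        d v (x + t *\<^sub>R w + 0 *\<^sub>R v) - d v (x + 0 *\<^sub>R v)) (at 0 within {-e..e})"
      by (rule has_vector_derivative_transform[rotated 2])
         (use e t int1 in \<open>auto simp: sw[symmetric] dest!: integral_unique\<close>)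
    have "d v (x + t *\<^sub>R w + 0 *\<^sub>R v) - d v (x + 0 *\<^sub>R v) =
      integral (cbox 0 t) (\<lambda>\<tau>. dd w v (x + \<tau> *\<^sub>R w))"
      by (rule vector_derivative_unique_within_closed_interval[of "-e" e 0, unfolded box_real, OF _ _ 2 1]) (use e in auto)
    then show ?thesis by (simp add: algebra_simps)
  qed
  \<comment> \<open>It remains to differentiate \<open>key\<close> at \<open>t = 0\<close>, from the
    right since \<open>key\<close> concerns \<open>t \<ge> 0\<close>; one-sided derivatives within
    \<open>{0..e}\<close> are still unique.\<close>
  have "((\<lambda>t. integral {0..t} (\<lambda>\<tau>. dd w v (x + \<tau> *\<^sub>R w))) has_vector_derivative
        dd w v (x + 0 *\<^sub>R w)) (at 0 within {0..e})"
    by (rule integral_has_vector_derivative)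
       (use e inS[of 0] in \<open>auto intro!: cdd continuous_intros\<close>)
  then have "((\<lambda>t. d v x + integral {0..t} (\<lambda>\<tau>. dd w v (x + \<tau> *\<^sub>R w))) has_vector_derivative
        dd w v (x + 0 *\<^sub>R w)) (at 0 within {0..e})"
    by (auto intro!: derivative_eq_intros)
  then have 2: "((\<lambda>t. d v (x + t *\<^sub>R w)) has_vector_derivative dd w v x) (at 0 within {0..e})"
    using key e
    by (intro has_vector_derivative_transform[of 0 "{0..e}" "\<lambda>t. d v (x + t *\<^sub>R w)"]) auto
  have 3: "((\<lambda>t. d v (x + t *\<^sub>R w)) has_vector_derivative dd v w (x + 0 *\<^sub>R w)) (at 0 within {0..e})"
    unfolding dd_def by (rule Ck_on_along_line[OF C'(2)]) (use S in auto)
  have "dd v w (x + 0 *\<^sub>R w) = dd w v x"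
    by (rule vector_derivative_unique_within_closed_interval[of 0 e 0, unfolded box_real, OF _ _ 3 2])
       (use e in auto)
  then show ?thesis by (simp add: dd_def d_def[abs_def])
qed

section \<open>Smooth functions and their Wirtinger derivatives\<close>

lemma smooth_on_Ck: "smooth_on f S \<Longrightarrow> Ck_on k f S"
  by (simp add: smooth_on_def)

lemma smooth_on_has_derivative:
  "smooth_on f S \<Longrightarrow> x \<in> S \<Longrightarrow> (f has_derivative frechet_derivative f (at x)) (at x)"
  using Ck_on_has_derivative smooth_on_Ck by blast

lemma smooth_on_differentiable:
  "smooth_on f S \<Longrightarrow> x \<in> S \<Longrightarrow> f differentiable (at x)"
  using smooth_on_has_derivative by (auto simp: differentiable_def)

lemma smooth_on_continuous_on: "smooth_on f S \<Longrightarrow> continuous_on S f"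
  using smooth_on_Ck Ck_on_imp_continuous_on by blast

lemma smooth_on_frechet_derivative:
  "smooth_on f S \<Longrightarrow> smooth_on (\<lambda>x. frechet_derivative f (at x) v) S"
  unfolding smooth_on_def by (metis Ck_on.simps(2))

lemma smooth_on_bounded_linear:
  "open S \<Longrightarrow> bounded_linear L \<Longrightarrow> smooth_on f S \<Longrightarrow> smooth_on (\<lambda>x. L (f x)) S"
  by (simp add: smooth_on_def Ck_on_bounded_linear)

lemma smooth_on_add:
  "open S \<Longrightarrow> smooth_on f S \<Longrightarrow> smooth_on g S \<Longrightarrow> smooth_on (\<lambda>x. f x + g x) S"
  by (simp add: smooth_on_def Ck_on_add)

lemma smooth_on_cong:
  "open S \<Longrightarrow> (\<And>x. x \<in> S \<Longrightarrow> f x = g x) \<Longrightarrow> smooth_on f S \<Longrightarrow> smooth_on g S"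
  unfolding smooth_on_def using Ck_on_cong by blast

lemma smooth_on_dz:
  assumes "open S" "smooth_on f S"
  shows "smooth_on (dz \<alpha> f) S" "smooth_on (dzbar \<alpha> f) S"
proof -
  have lc: "smooth_on (\<lambda>x. a * frechet_derivative f (at x) (axis \<alpha> 1)
      + b * frechet_derivative f (at x) (axis \<alpha> \<i>)) S" for a b :: complex
    using smooth_on_bounded_linear[OF assms(1) bounded_linear_mult_right
        smooth_on_frechet_derivative[OF assms(2)]]
    by (rule smooth_on_add[OF assms(1)])
      (rule smooth_on_bounded_linear[OF assms(1) bounded_linear_mult_right
        smooth_on_frechet_derivative[OF assms(2)]])
  show "smooth_on (dz \<alpha> f) S"
    by (rule smooth_on_cong[OF assms(1) _ lc[of "1/2" "-\<i>/2"]]) (simp add: dz_def field_simps)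
  show "smooth_on (dzbar \<alpha> f) S"
    by (rule smooth_on_cong[OF assms(1) _ lc[of "1/2" "\<i>/2"]]) (simp add: dzbar_def field_simps)
qed

section \<open>Unique continuation\<close>

text \<open>\<open>H\<close> plays the squared norm on a circle and \<open>D / H\<close> the
  frequency. Dividing \<open>convex\<close> by \<open>H\<^sup>2\<close> shows that
  \<open>D / H + K\<^sup>2 / 2 * s\<close> is nondecreasing where \<open>H > 0\<close>, so the
  frequency stays bounded above when \<open>s\<close> decreases towards a zero of \<open>H\<close>.
  Then \<open>H' \<le> C H\<close>, and \<open>H\<close> cannot reach zero there: it decays at most
  exponentially.\<close>

lemma frequency_unique_continuation:
  fixes H D E D' :: "real \<Rightarrow> real"
  assumes ab: "a \<le> b" and K: "K \<ge> 0"
    and H: "\<And>s. s \<in> {a..b} \<Longrightarrow> (H has_real_derivative 2 * D s + E s) (at s)"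
    and D: "\<And>s. s \<in> {a..b} \<Longrightarrow> (D has_real_derivative D' s) (at s)"
    and E: "\<And>s. s \<in> {a..b} \<Longrightarrow> \<bar>E s\<bar> \<le> 2 * K * H s"
    and convex: "\<And>s. s \<in> {a..b} \<Longrightarrow> D' s * H s - D s * (2 * D s + E s) \<ge> - (K\<^sup>2 / 2) * (H s)\<^sup>2"
    and pos: "\<And>s. s \<in> {a..b} \<Longrightarrow> H s \<ge> 0" and zero: "H a = 0"
  shows "H b = 0"
proof (rule ccontr)
  assume "H b \<noteq> 0"
  then have Hb: "H b > 0" using pos[of b] ab by auto
  have contH: "continuous_on {a..b} H"
    using H by (intro continuous_at_imp_continuous_on ballI DERIV_isCont)
  have "compact {t \<in> {a..b}. H t = 0}"
    using continuous_closed_preimage_constant[OF contH, of 0]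
    unfolding compact_eq_bounded_closed by (auto intro: bounded_subset[of "{a..b}"])
  moreover have "a \<in> {t \<in> {a..b}. H t = 0}" using zero ab by auto
  \<comment> \<open>The last zero of \<open>H\<close>; the frequency is defined on all of
    \<open>(c, b]\<close>.\<close>
  ultimately obtain c where c: "c \<in> {a..b}" "H c = 0"
    and cmax: "\<And>t. t \<in> {a..b} \<Longrightarrow> H t = 0 \<Longrightarrow> t \<le> c"
    using compact_attains_sup[of "{t \<in> {a..b}. H t = 0}"] by blast
  have cb: "c < b" using c Hb by (cases "c = b") auto
  have Hpos: "H t > 0" if "c < t" "t \<le> b" for t
    using cmax[of t] pos[of t] that c by fastforce
  \<comment> \<open>\<open>X\<close> is the frequency at \<open>b\<close> plus the largest possible
    drift over \<open>(c, b]\<close>; \<open>C\<close> adds the contribution of the error term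
    \<open>E\<close>.\<close>
  define X where "X = D b / H b + K\<^sup>2 / 2 * (b - c)"
  define C where "C = 2 * X + 2 * K"
  have N: "D s / H s \<le> X" if s: "c < s" "s \<le> b" for s
  proof -
    have "D s / H s + K\<^sup>2 / 2 * s \<le> D b / H b + K\<^sup>2 / 2 * b"
    proof (rule DERIV_nonneg_imp_nondecreasing[OF s(2)])
      fix x assume x: "s \<le> x" "x \<le> b"
      then have xs: "x \<in> {a..b}" "H x > 0" using Hpos c s by auto
      let ?y = "(D' x * H x - D x * (2 * D x + E x)) / (H x * H x) + K\<^sup>2 / 2"
      have "((\<lambda>s. D s / H s + K\<^sup>2 / 2 * s) has_real_derivative ?y) (at x)"
        using H[OF xs(1)] D[OF xs(1)] xs(2)
        by (auto intro!: derivative_eq_intros)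
      moreover have "?y \<ge> 0"
        using convex[OF xs(1)] xs(2) by (simp add: field_simps power2_eq_square)
      ultimately show "\<exists>y. ((\<lambda>s. D s / H s + K\<^sup>2 / 2 * s) has_real_derivative y) (at x) \<and> 0 \<le> y"
        by blast
    qed
    moreover have "K\<^sup>2 / 2 * (b - s) \<le> K\<^sup>2 / 2 * (b - c)"
      using s by (intro mult_left_mono) auto
    ultimately show ?thesis unfolding X_def right_diff_distrib by linarith
  qed
  define G where "G s = H s * exp (- C * s)" for s
  have G: "G b \<le> G s" if s: "c < s" "s \<le> b" for s
  proof (rule DERIV_nonpos_imp_nonincreasing[OF s(2)])
    fix x assume x: "s \<le> x" "x \<le> b"
    then have xs: "x \<in> {a..b}" "H x > 0" "c < x" using Hpos c s by auto
    have "(G has_real_derivative (2 * D x + E x - C * H x) * exp (- C * x)) (at x)"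
      unfolding G_def using H[OF xs(1)]
      by (auto intro!: derivative_eq_intros simp: algebra_simps)
    moreover have "2 * D x + E x \<le> C * H x"
    proof -
      have "D x \<le> X * H x"
        using N[OF xs(3) x(2)] xs(2) by (simp add: pos_divide_le_eq)
      then have "2 * D x \<le> (C - 2 * K) * H x" by (simp add: C_def)
      then show ?thesis using E[OF xs(1)] by (simp add: left_diff_distrib)
    qed
    then have "(2 * D x + E x - C * H x) * exp (- C * x) \<le> 0"
      by (simp add: mult_nonpos_nonneg)
    ultimately show "\<exists>y. (G has_real_derivative y) (at x) \<and> y \<le> 0" by blast
  qed
  have "isCont H c" using H[OF c(1)] DERIV_isCont by blast
  then have "isCont G c" unfolding G_def by (intro continuous_intros)
  then have "(G \<longlongrightarrow> G c) (at_right c)"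
    by (simp add: isCont_def filterlim_at_split)
  moreover have "\<forall>\<^sub>F s in at_right c. G b \<le> G s"
    using eventually_at_right_less[of c] eventually_at_right_real[OF cb]
    by eventually_elim (use G in auto)
  ultimately have "G b \<le> G c"
    by (rule tendsto_lowerbound) simp
  then show False using Hb c by (simp add: G_def mult_le_0_iff not_le)
qed

text \<open>Cauchy-Schwarz in discriminant form, to be applied to integrals of inner products over a
  circle, where \<open>h\<close> may vanish.\<close>

lemma quadratic_form_Cauchy_Schwarz:
  fixes \<alpha> \<beta> h :: real
  assumes "\<And>x. \<alpha> - 2 * x * \<beta> + x\<^sup>2 * h \<ge> 0" "h \<ge> 0"
  shows "\<beta>\<^sup>2 \<le> \<alpha> * h"
proof (cases "h = 0")
  case True
  have "\<beta> = 0"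
  proof (rule ccontr)
    assume "\<beta> \<noteq> 0"
    \<comment> \<open>With \<open>h = 0\<close> this choice of \<open>x\<close> gives the quadratic
      the value -1.\<close>
    then show False using assms(1)[of "(\<alpha> + 1) / (2 * \<beta>)"] True by simp
  qed
  then show ?thesis using True by simp
next
  case False
  then have h: "h > 0" using assms(2) by simp
  have "\<alpha> - 2 * (\<beta> / h) * \<beta> + (\<beta> / h)\<^sup>2 * h = \<alpha> - \<beta>\<^sup>2 / h"
    using h by (simp add: field_simps power2_eq_square)
  then have "\<beta>\<^sup>2 / h \<le> \<alpha>" using assms(1)[of "\<beta> / h"] by simp
  then show ?thesis using h by (simp add: pos_divide_le_eq)
qed

text \<open>With \<open>L = -J \<partial>\<^sub>\<theta>\<close>, which is symmetric on the circle, the hypothesis reads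
  \<open>\<bar>w\<^sub>s - L w\<bar> \<le> K \<bar>w\<bar>\<close>; the frequency \<open>\<langle>L w, w\<rangle> / \<parallel>w\<parallel>\<^sup>2\<close>
  is then almost monotone in \<open>s\<close>.\<close>

lemma circle_unique_continuation:
  fixes w ws wt wst :: "real \<Rightarrow> real \<Rightarrow> 'v::euclidean_space" and J :: "'v \<Rightarrow> 'v"
  assumes J: "bounded_linear J" and skew: "\<And>x y. J x \<bullet> y = - (x \<bullet> J y)"
    and U: "open U" "convex U" and ab: "a \<in> U" "b \<in> U" "a \<le> b" and K: "K \<ge> 0"
    and w_s: "\<And>s t. s \<in> U \<Longrightarrow> ((\<lambda>s. w s t) has_vector_derivative ws s t) (at s within U)"
    and wt_s: "\<And>s t. s \<in> U \<Longrightarrow> ((\<lambda>s. wt s t) has_vector_derivative wst s t) (at s within U)"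
    and w_t: "\<And>s t. s \<in> U \<Longrightarrow> ((\<lambda>t. w s t) has_vector_derivative wt s t) (at t within {0..2*pi})"
    and ws_t: "\<And>s t. s \<in> U \<Longrightarrow> ((\<lambda>t. ws s t) has_vector_derivative wst s t) (at t within {0..2*pi})"
    and cont: "continuous_on (U \<times> {0..2*pi}) (\<lambda>(s,t). w s t)"
      "continuous_on (U \<times> {0..2*pi}) (\<lambda>(s,t). ws s t)"
      "continuous_on (U \<times> {0..2*pi}) (\<lambda>(s,t). wt s t)"
      "continuous_on (U \<times> {0..2*pi}) (\<lambda>(s,t). wst s t)"
    and per: "\<And>s. w s (2*pi) = w s 0" "\<And>s. ws s (2*pi) = ws s 0"
    and bound: "\<And>s t. s \<in> U \<Longrightarrow> norm (ws s t + J (wt s t)) \<le> K * norm (w s t)"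
    and zero: "\<And>t. t \<in> {0..2*pi} \<Longrightarrow> w a t = 0"
    and t: "t \<in> {0..2*pi}"
  shows "w b t = 0"
proof -
  define I :: "(real \<Rightarrow> real) \<Rightarrow> real" where "I = integral {0..2*pi}"
  have sub: "{a..b} \<subseteq> U"
    using U(2) ab by (metis atLeastAtMost_iff convex_contains_segment closed_segment_eq_real_ivl subsetI subsetD)
  have cs: "continuous_on {0..2*pi} (h s)" if "s \<in> U" "continuous_on (U \<times> {0..2*pi}) (\<lambda>(s,t). h s t)"
    for s and h :: "real \<Rightarrow> real \<Rightarrow> 'v"
  proof -
    have "continuous_on {0..2*pi} (\<lambda>t. (\<lambda>(s,t). h s t) (s, t))"
      by (rule continuous_on_compose2[OF that(2)]) (use that(1) in \<open>auto intro!: continuous_intros\<close>)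
    then show ?thesis by simp
  qed
  note c1 = cs[OF _ cont(1)] cs[OF _ cont(2)] cs[OF _ cont(3)] cs[OF _ cont(4)]
  have Jc: "continuous_on A (\<lambda>x. J (h x))" if "continuous_on A h" for h :: "'c::topological_space \<Rightarrow> 'v" and A
    using J that by (rule bounded_linear.continuous_on)
  define L where "L s t = - J (wt s t)" for s t
  define F where "F s t = ws s t - L s t" for s t
  have c2: "continuous_on {0..2*pi} (L s)" "continuous_on {0..2*pi} (F s)" if "s \<in> U" for s
    unfolding L_def F_def using that c1 by (auto intro!: continuous_intros Jc)
  have Fb: "norm (F s t) \<le> K * norm (w s t)" if "s \<in> U" for s t
    using bound[OF that] by (simp add: F_def L_def)
  define H where "H s = I (\<lambda>t. w s t \<bullet> w s t)" for s
  define D where "D s = I (\<lambda>t. L s t \<bullet> w s t)" for s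
  define E where "E s = 2 * I (\<lambda>t. F s t \<bullet> w s t)" for s
  define D' where "D' s = 2 * I (\<lambda>t. L s t \<bullet> ws s t)" for s
  have int: "h integrable_on {0..2*pi}" if "continuous_on {0..2*pi} h" for h :: "real \<Rightarrow> real"
    using that by (rule integrable_continuous_real)
  have Iadd: "I (\<lambda>t. x * h t + y * k t) = x * I h + y * I k"
    if "continuous_on {0..2*pi} h" "continuous_on {0..2*pi} k" for h k x y
    unfolding I_def using that
    by (subst integral_add) (auto intro!: int continuous_intros)
  have Imono: "I h \<le> I k" if "continuous_on {0..2*pi} h" "continuous_on {0..2*pi} k"
    "\<And>t. h t \<le> k t" for h k
    unfolding I_def using that by (intro integral_le int) auto
  have Ipos: "0 \<le> I h" if "continuous_on {0..2*pi} h" "\<And>t. 0 \<le> h t" for h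
    unfolding I_def using that by (intro integral_nonneg int) auto
  have H': "(H has_real_derivative 2 * D s + E s) (at s)" if s: "s \<in> U" for s
  proof -
    have "((\<lambda>s. integral (cbox 0 (2*pi)) (\<lambda>t. w s t \<bullet> w s t)) has_vector_derivative
       integral (cbox 0 (2*pi)) (\<lambda>t. w s t \<bullet> ws s t + ws s t \<bullet> w s t)) (at s within U)"
    proof (rule leibniz_rule_vector_derivative)
      fix s t :: real assume "s \<in> U"
      then show "((\<lambda>s. w s t \<bullet> w s t) has_vector_derivative (w s t \<bullet> ws s t + ws s t \<bullet> w s t)) (at s within U)"
        by (intro bounded_bilinear.has_vector_derivative[OF bounded_bilinear_inner] w_s)
    next
      show "continuous_on (U \<times> cbox 0 (2 * pi)) (\<lambda>(s, t). w s t \<bullet> ws s t + ws s t \<bullet> w s t)"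
        using cont by (auto simp: split_beta intro!: continuous_intros)
    qed (use c1 s U in \<open>auto intro!: int continuous_intros\<close>)
    moreover have "I (\<lambda>t. w s t \<bullet> ws s t + ws s t \<bullet> w s t) = 2 * D s + E s"
    proof -
      have "I (\<lambda>t. w s t \<bullet> ws s t + ws s t \<bullet> w s t) = I (\<lambda>t. 2 * (L s t \<bullet> w s t) + 2 * (F s t \<bullet> w s t))"
        by (simp add: F_def algebra_simps inner_commute)
      also have "\<dots> = 2 * D s + E s"
        unfolding D_def E_def using s c1 c2 by (subst Iadd) (auto intro!: continuous_intros)
      finally show ?thesis .
    qed
    ultimately show ?thesis
      using at_within_open[OF s U(1)]
      by (simp add: H_def[abs_def] I_def has_real_derivative_iff_has_vector_derivative)
  qed
  have D'': "(D has_real_derivative D' s) (at s)" if s: "s \<in> U" for s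
  proof -
    have "((\<lambda>s. integral (cbox 0 (2*pi)) (\<lambda>t. L s t \<bullet> w s t)) has_vector_derivative
       integral (cbox 0 (2*pi)) (\<lambda>t. L s t \<bullet> ws s t + (- J (wst s t)) \<bullet> w s t)) (at s within U)"
    proof (rule leibniz_rule_vector_derivative)
      fix s t :: real assume "s \<in> U"
      then show "((\<lambda>s. L s t \<bullet> w s t) has_vector_derivative (L s t \<bullet> ws s t + (- J (wst s t)) \<bullet> w s t)) (at s within U)"
        unfolding L_def
        by (intro bounded_bilinear.has_vector_derivative[OF bounded_bilinear_inner] w_s
            has_vector_derivative_minus bounded_linear.has_vector_derivative[OF J] wt_s)
    next
      have "continuous_on (U \<times> {0..2*pi}) (\<lambda>(s, t). J (wt s t))" "continuous_on (U \<times> {0..2*pi}) (\<lambda>(s, t). J (wst s t))"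
        using cont by (auto simp: split_beta intro!: Jc)
      then show "continuous_on (U \<times> cbox 0 (2 * pi)) (\<lambda>(s, t). L s t \<bullet> ws s t + (- J (wst s t)) \<bullet> w s t)"
        using cont by (auto simp: split_beta L_def intro!: continuous_intros)
    qed (use c1 c2 s U in \<open>auto intro!: int continuous_intros\<close>)
    moreover have "I (\<lambda>t. L s t \<bullet> ws s t + (- J (wst s t)) \<bullet> w s t) = D' s"
    proof -
      \<comment> \<open>Symmetry of \<open>L\<close>: by periodicity the \<open>t\<close>-derivative
        of \<open>ws \<bullet> J w\<close> integrates to zero over the circle. Hence
        \<open>L ws \<bullet> w\<close> and \<open>L w \<bullet> ws\<close> have equal integrals,
        which accounts for the factor 2 in \<open>D'\<close>.\<close>
      have "((\<lambda>t. ws s t \<bullet> J (wt s t) + wst s t \<bullet> J (w s t)) has_integral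
          ws s (2*pi) \<bullet> J (w s (2*pi)) - ws s 0 \<bullet> J (w s 0)) {0..2*pi}"
        using s by (intro fundamental_theorem_of_calculus
            bounded_bilinear.has_vector_derivative[OF bounded_bilinear_inner] ws_t
            bounded_linear.has_vector_derivative[OF J] w_t) auto
      then have "I (\<lambda>t. 1 * (ws s t \<bullet> J (wt s t)) + 1 * (wst s t \<bullet> J (w s t))) = 0"
        unfolding I_def per by (simp add: integral_unique)
      then have *: "I (\<lambda>t. ws s t \<bullet> J (wt s t)) + I (\<lambda>t. wst s t \<bullet> J (w s t)) = 0"
        using s c1 by (subst (asm) Iadd) (auto intro!: continuous_intros Jc)
      have "L s t \<bullet> ws s t = (-1) * (ws s t \<bullet> J (wt s t))" for t
        by (simp add: L_def inner_commute)
      moreover have "(- J (wst s t)) \<bullet> w s t = 1 * (wst s t \<bullet> J (w s t))" for t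
        by (simp add: skew)
      ultimately have "I (\<lambda>t. L s t \<bullet> ws s t + (- J (wst s t)) \<bullet> w s t) =
        I (\<lambda>t. (-1) * (ws s t \<bullet> J (wt s t)) + 1 * (wst s t \<bullet> J (w s t)))"
        by presburger
      also have "\<dots> = - I (\<lambda>t. ws s t \<bullet> J (wt s t)) + I (\<lambda>t. wst s t \<bullet> J (w s t))"
        using s c1 by (subst Iadd) (auto intro!: continuous_intros Jc)
      \<comment> \<open>The vacuous summand gives the scalar multiple the two-term shape of
        \<open>Iadd\<close>.\<close>
      also have "\<dots> = (-2) * I (\<lambda>t. ws s t \<bullet> J (wt s t)) + 0 * I (\<lambda>t. 0)" using * by simp
      also have "\<dots> = I (\<lambda>t. (-2) * (ws s t \<bullet> J (wt s t)) + 0 * 0)"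
        using s c1 by (subst Iadd) (auto intro!: continuous_intros Jc)
      also have "\<dots> = D' s" 
        unfolding D'_def I_def L_def by (simp add: inner_commute)
      finally show ?thesis .
    qed
    ultimately show ?thesis
      using at_within_open[OF s U(1)]
      by (simp add: D_def[abs_def] I_def has_real_derivative_iff_has_vector_derivative)
  qed
  have Hpos: "H s \<ge> 0" if "s \<in> U" for s
    unfolding H_def using c1 that by (auto intro!: Ipos continuous_intros)
  have Eb: "\<bar>E s\<bar> \<le> 2 * K * H s" if s: "s \<in> U" for s
  proof -
    have FW: "\<bar>F s t \<bullet> w s t\<bar> \<le> K * (w s t \<bullet> w s t)" for t
    proof -
      have "\<bar>F s t \<bullet> w s t\<bar> \<le> norm (F s t) * norm (w s t)" by (rule Cauchy_Schwarz_ineq2)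
      also have "\<dots> \<le> K * norm (w s t) * norm (w s t)" using Fb[OF s] by (intro mult_right_mono) auto
      finally show ?thesis by (simp add: dot_square_norm power2_eq_square)
    qed
    have KH: "I (\<lambda>t. K * (w s t \<bullet> w s t)) = K * H s" unfolding H_def I_def by simp
    have "I (\<lambda>t. F s t \<bullet> w s t) \<le> K * H s"
      unfolding KH[symmetric] using c1 c2 s FW by (intro Imono continuous_intros) (auto simp: abs_le_iff)
    moreover have "I (\<lambda>t. - (F s t \<bullet> w s t)) \<le> K * H s"
      unfolding KH[symmetric] using c1 c2 s FW by (intro Imono continuous_intros) (auto simp: abs_le_iff)
    then have "- I (\<lambda>t. F s t \<bullet> w s t) \<le> K * H s" by (simp add: I_def)
    ultimately show ?thesis by (simp add: E_def abs_le_iff)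
  qed
  have conv: "D' s * H s - D s * (2 * D s + E s) \<ge> - (K\<^sup>2 / 2) * (H s)\<^sup>2" if s: "s \<in> U" for s
  proof -
    \<comment> \<open>\<open>P\<close> is the midpoint of \<open>L w\<close> and
      \<open>ws = L w + F\<close>. Around it the cross terms cancel: \<open>L w \<bullet> ws\<close>
      becomes \<open>|P|\<^sup>2 - |F|\<^sup>2 / 4\<close>, and \<open>D * (2 * D + E)\<close>
      becomes \<open>2 \<beta>\<^sup>2 - \<gamma>\<^sup>2 / 2\<close>. Apart from Cauchy-Schwarz for
      \<open>P\<close> and \<open>w\<close>, only \<open>\<phi> * H / 2\<close> has to be estimated,
      whence the constant \<open>K\<^sup>2 / 2\<close>.\<close>
    define P where "P t = L s t + (1/2) *\<^sub>R F s t" for t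
    define \<alpha> where "\<alpha> = I (\<lambda>t. P t \<bullet> P t)"
    define \<beta> where "\<beta> = I (\<lambda>t. P t \<bullet> w s t)"
    define \<gamma> where "\<gamma> = I (\<lambda>t. F s t \<bullet> w s t)"
    define \<phi> where "\<phi> = I (\<lambda>t. F s t \<bullet> F s t)"
    have cP: "continuous_on {0..2*pi} P"
      unfolding P_def using c2[OF s] by (intro continuous_intros)
    note cc = c1(1)[OF s] c2[OF s] cP
    have 1: "D' s = 2 * \<alpha> - \<phi> / 2"
    proof -
      have "2 * \<alpha> + (-1/2) * \<phi> = I (\<lambda>t. 2 * (P t \<bullet> P t) + (-1/2) * (F s t \<bullet> F s t))"
        unfolding \<alpha>_def \<phi>_def using cc by (subst Iadd) (auto intro!: continuous_intros)
      also have "\<dots> = I (\<lambda>t. 2 * (L s t \<bullet> ws s t))"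
        by (simp add: P_def F_def inner_commute algebra_simps)
      finally show ?thesis by (simp add: D'_def I_def)
    qed
    have 2: "D s = \<beta> - \<gamma> / 2"
    proof -
      have "1 * \<beta> + (-1/2) * \<gamma> = I (\<lambda>t. 1 * (P t \<bullet> w s t) + (-1/2) * (F s t \<bullet> w s t))"
        unfolding \<beta>_def \<gamma>_def using cc by (subst Iadd) (auto intro!: continuous_intros)
      also have "\<dots> = D s"
        unfolding D_def by (simp add: P_def inner_commute algebra_simps)
      finally show ?thesis by simp
    qed
    have 3: "\<beta>\<^sup>2 \<le> \<alpha> * H s"
    proof (rule quadratic_form_Cauchy_Schwarz[OF _ Hpos[OF s]])
      fix x
      have i: "I (\<lambda>t. 1 * (P t \<bullet> P t) + (- 2 * x) * (P t \<bullet> w s t)) = 1 * \<alpha> + (- 2 * x) * \<beta>"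
        unfolding \<alpha>_def \<beta>_def using cc by (intro Iadd continuous_intros)
      have "I (\<lambda>t. 1 * (1 * (P t \<bullet> P t) + (- 2 * x) * (P t \<bullet> w s t)) + x\<^sup>2 * (w s t \<bullet> w s t))
          = 1 * I (\<lambda>t. 1 * (P t \<bullet> P t) + (- 2 * x) * (P t \<bullet> w s t)) + x\<^sup>2 * H s"
        unfolding H_def using cc by (intro Iadd continuous_intros)
      then have "\<alpha> - 2 * x * \<beta> + x\<^sup>2 * H s
          = I (\<lambda>t. 1 * (1 * (P t \<bullet> P t) + (- 2 * x) * (P t \<bullet> w s t)) + x\<^sup>2 * (w s t \<bullet> w s t))"
        unfolding i by simp
      also have "\<dots> = I (\<lambda>t. (P t - x *\<^sub>R w s t) \<bullet> (P t - x *\<^sub>R w s t))"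
        by (simp add: inner_commute algebra_simps power2_eq_square)
      also have "\<dots> \<ge> 0" using cc by (intro Ipos continuous_intros) auto
      finally show "\<alpha> - 2 * x * \<beta> + x\<^sup>2 * H s \<ge> 0" .
    qed
    have 4: "\<phi> \<le> K\<^sup>2 * H s"
    proof -
      have "\<phi> \<le> I (\<lambda>t. K\<^sup>2 * (w s t \<bullet> w s t))"
        unfolding \<phi>_def
      proof (intro Imono)
        fix t
        have "(norm (F s t))\<^sup>2 \<le> (K * norm (w s t))\<^sup>2"
          using Fb[OF s] by (intro power_mono) auto
        then show "F s t \<bullet> F s t \<le> K\<^sup>2 * (w s t \<bullet> w s t)"
          by (simp add: dot_square_norm power_mult_distrib)
      qed (use cc in \<open>auto intro!: continuous_intros\<close>)
      then show ?thesis by (simp add: I_def H_def)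
    qed
    have "D' s * H s - D s * (2 * D s + E s) = 2 * (\<alpha> * H s - \<beta>\<^sup>2) + \<gamma>\<^sup>2 / 2 - \<phi> * H s / 2"
      unfolding 1 2 E_def \<gamma>_def[symmetric] by (simp add: algebra_simps power2_eq_square)
    moreover have "\<phi> * H s \<le> K\<^sup>2 * H s * H s"
      using 4 Hpos[OF s] by (intro mult_right_mono)
    moreover have "\<gamma>\<^sup>2 \<ge> 0" by simp
    ultimately show ?thesis using 3 unfolding power2_eq_square[of "H s"] by argo
  qed
  have "H a = 0"
    using integral_cong[of "{0..2*pi}" "\<lambda>t. w a t \<bullet> w a t" "\<lambda>t. 0"] zero by (simp add: H_def I_def)
  then have "H b = 0"
    by (intro frequency_unique_continuation[where H = H and D = D and E = E and D' = D' and K = K and a = a and b = b]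
        H' D'' Eb conv Hpos ab K) (use sub in auto)
  moreover have "continuous_on {0..2*pi} (\<lambda>t. w b t \<bullet> w b t)"
    using c1(1)[OF ab(2)] by (intro continuous_intros)
  ultimately have "w b t \<bullet> w b t = 0"
    using integral_eq_0_iff[of 0 "2*pi" "\<lambda>t. w b t \<bullet> w b t"] t by (auto simp: H_def I_def)
  then show ?thesis by simp
qed

text \<open>In logarithmic polar coordinates \<open>z = exp (s + i t)\<close> the curves
  \<open>s\<close> and \<open>t\<close> have velocities \<open>z\<close> and \<open>i z\<close>; the
  two formulas expand the derivative in these directions.\<close>

lemma Ck_on_polar:
  fixes g :: "complex \<Rightarrow> 'v::euclidean_space"
  assumes "Ck_on (Suc k) g S" and z: "exp (Complex s t) \<in> S"
  defines "z \<equiv> exp (Complex s t)"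
  shows "((\<lambda>s. g (exp (Complex s t))) has_vector_derivative
      Re z *\<^sub>R frechet_derivative g (at z) 1 + Im z *\<^sub>R frechet_derivative g (at z) \<i>) (at s within A)"
    and "((\<lambda>t. g (exp (Complex s t))) has_vector_derivative
      Re z *\<^sub>R frechet_derivative g (at z) \<i> - Im z *\<^sub>R frechet_derivative g (at z) 1) (at t within B)"
proof -
  have g: "(g has_derivative frechet_derivative g (at z)) (at z)"
    using Ck_on_has_derivative[OF assms(1)] z by (simp add: z_def)
  then have lin: "linear (frechet_derivative g (at z))"
    by (rule has_derivative_linear)
  have dec: "frechet_derivative g (at z) w
      = Re w *\<^sub>R frechet_derivative g (at z) 1 + Im w *\<^sub>R frechet_derivative g (at z) \<i>" for w
  proof -
    have "w = Re w *\<^sub>R 1 + Im w *\<^sub>R \<i>" by (simp add: complex_eq_iff)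
    then have "frechet_derivative g (at z) w = frechet_derivative g (at z) (Re w *\<^sub>R 1 + Im w *\<^sub>R \<i>)"
      by simp
    then show ?thesis by (simp only: linear_add[OF lin] linear_scale[OF lin])
  qed
  have "((\<lambda>s. exp (Complex s t)) has_vector_derivative z) (at s within A)"
    unfolding Complex_eq z_def
    by (rule has_vector_derivative_real_field) (auto intro!: derivative_eq_intros)
  then have "((\<lambda>s. g (exp (Complex s t))) has_vector_derivative frechet_derivative g (at z) z) (at s within A)"
    using vector_derivative_diff_chain_within[of "\<lambda>s. exp (Complex s t)" z s A g] 
      has_derivative_at_withinI[OF g]
    by (simp add: o_def z_def)
  then show "((\<lambda>s. g (exp (Complex s t))) has_vector_derivative
      Re z *\<^sub>R frechet_derivative g (at z) 1 + Im z *\<^sub>R frechet_derivative g (at z) \<i>) (at s within A)"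
    by (simp add: dec[of z])
  have "((\<lambda>t. exp (Complex s t)) has_vector_derivative \<i> * z) (at t within B)"
    unfolding Complex_eq z_def
    by (rule has_vector_derivative_real_field[where f = "\<lambda>w. exp (of_real s + \<i> * w)"])
      (auto intro!: derivative_eq_intros)
  then have "((\<lambda>t. g (exp (Complex s t))) has_vector_derivative frechet_derivative g (at z) (\<i> * z)) (at t within B)"
    using vector_derivative_diff_chain_within[of "\<lambda>t. exp (Complex s t)" "\<i> * z" t B g] 
      has_derivative_at_withinI[OF g]
    by (simp add: o_def z_def)
  then show "((\<lambda>t. g (exp (Complex s t))) has_vector_derivative
      Re z *\<^sub>R frechet_derivative g (at z) \<i> - Im z *\<^sub>R frechet_derivative g (at z) 1) (at t within B)"
    by (simp add: dec[of "\<i> * z"])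
qed

text \<open>With \<open>J\<close> as multiplication by \<open>i\<close>, the hypothesis bounds twice
  the \<open>dbar\<close>-derivative of \<open>u\<close>. In logarithmic polar coordinates the
  operator \<open>\<partial>\<^sub>x + J \<partial>\<^sub>y\<close> becomes
  \<open>\<partial>\<^sub>s + J \<partial>\<^sub>t\<close> up to the factor \<open>cnj z\<close>, so
  \<open>circle_unique_continuation\<close> applies, starting from a small circle on which
  \<open>u\<close> vanishes. The origin is not covered by these coordinates and is treated
  apart.\<close>

lemma disc_unique_continuation:
  fixes u :: "complex \<Rightarrow> 'v::euclidean_space" and J :: "'v \<Rightarrow> 'v"
  assumes J: "bounded_linear J" and skew: "\<And>x y. J x \<bullet> y = - (x \<bullet> J y)" and JJ: "\<And>x. J (J x) = - x"
    and C: "Ck_on 2 u (ball 0 R)" and K: "K \<ge> 0"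
    and bound: "\<And>z. z \<in> ball 0 R \<Longrightarrow>
      norm (frechet_derivative u (at z) 1 + J (frechet_derivative u (at z) \<i>)) \<le> K * norm (u z)"
    and r: "r > 0" and zero: "\<And>z. z \<in> ball 0 r \<Longrightarrow> u z = 0" and z: "z \<in> ball 0 R"
  shows "u z = 0"
proof (cases "z = 0")
  case True
  then show ?thesis using r zero by simp
next
  case False
  have R: "R > 0" using z le_less_trans[OF norm_ge_zero] by auto
  define e where "e s t = exp (Complex s t)" for s t
  define d where "d v z = frechet_derivative u (at z) v" for v z
  define dd where "dd v w z = frechet_derivative (d v) (at z) w" for v w z
  have C': "Ck_on (Suc (Suc 0)) u (ball 0 R)" "\<And>v. Ck_on (Suc 0) (d v) (ball 0 R)" "\<And>v w. Ck_on 0 (dd v w) (ball 0 R)"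
    using C unfolding d_def dd_def by (simp_all add: numeral_2_eq_2)
  have sym: "dd 1 \<i> z = dd \<i> 1 z" if "z \<in> ball 0 R" for z
    using frechet_derivative_commute[OF C _ that] by (simp add: dd_def d_def[abs_def])
  define U where "U = {..<ln R}"
  have norm_e: "norm (e s t) = exp s" for s t by (simp add: e_def)
  have inR: "e s t \<in> ball 0 R" if "s \<in> U" for s t
  proof -
    have "exp s < exp (ln R)" using that by (subst exp_less_cancel_iff) (auto simp: U_def)
    then show ?thesis using R by (simp add: norm_e)
  qed
  define w where "w s t = u (e s t)" for s t
  define ws where "ws s t = Re (e s t) *\<^sub>R d 1 (e s t) + Im (e s t) *\<^sub>R d \<i> (e s t)" for s t
  define wt where "wt s t = Re (e s t) *\<^sub>R d \<i> (e s t) - Im (e s t) *\<^sub>R d 1 (e s t)" for s t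
  define wst where "wst s t = (- Im (e s t)) *\<^sub>R d 1 (e s t) + Re (e s t) *\<^sub>R d \<i> (e s t)
     + Re (e s t) *\<^sub>R (Re (e s t) *\<^sub>R dd 1 \<i> (e s t) - Im (e s t) *\<^sub>R dd 1 1 (e s t))
     + Im (e s t) *\<^sub>R (Re (e s t) *\<^sub>R dd \<i> \<i> (e s t) - Im (e s t) *\<^sub>R dd \<i> 1 (e s t))" for s t
  note polar0 = Ck_on_polar[OF C'(1), folded d_def e_def]
  note polar1 = Ck_on_polar[OF C'(2), folded dd_def e_def]
  have eRe: "Re (e s t) = exp s * cos t" and eIm: "Im (e s t) = exp s * sin t" for s t
    by (simp_all add: e_def Re_exp Im_exp)
  have e_s: "((\<lambda>s. Re (e s t)) has_real_derivative Re (e s t)) (at s within A)"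
    "((\<lambda>s. Im (e s t)) has_real_derivative Im (e s t)) (at s within A)"
    "((\<lambda>t. Re (e s t)) has_real_derivative - Im (e s t)) (at t within A)"
    "((\<lambda>t. Im (e s t)) has_real_derivative Re (e s t)) (at t within A)" for s t A
    unfolding eRe eIm by (auto intro!: derivative_eq_intros)
  define arg where "arg = Arg2pi z"
  have arg: "arg \<in> {0..2*pi}" using Arg2pi[of z] by (auto simp: arg_def)
  define b where "b = ln (norm z)"
  have zb: "z = e b arg"
  proof -
    have "e b arg = of_real (exp b) * exp (\<i> * of_real arg)"
      by (simp add: e_def Complex_eq exp_add exp_of_real)
    then show ?thesis using Arg2pi_eq[of z] False by (simp add: b_def arg_def)
  qed
  have bU: "b \<in> U" using z False R by (simp add: b_def U_def)
  \<comment> \<open>The circle of radius \<open>exp a \<le> r / 2\<close> lies in the ball where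
    \<open>u\<close> is known to vanish; the minimum secures \<open>a \<le> b\<close>.\<close>
  define a where "a = min b (ln (r/2))"
  have aU: "a \<in> U" "a \<le> b" using bU by (auto simp: a_def U_def)
  have cu: "continuous_on (U \<times> {0..2*pi}) (\<lambda>(s,t). h (e s t))"
    if "continuous_on (ball 0 R) h" for h :: "complex \<Rightarrow> 'v"
    unfolding split_beta
    by (rule continuous_on_compose2[OF that])
       (use inR in \<open>auto simp: e_def Complex_eq intro!: continuous_intros\<close>)
  have ce: "continuous_on (U \<times> {0..2*pi}) (\<lambda>(s,t). Re (e s t))"
    "continuous_on (U \<times> {0..2*pi}) (\<lambda>(s,t). Im (e s t))"
    unfolding eRe eIm split_beta by (auto intro!: continuous_intros)
  have ch: "continuous_on (ball 0 R) u" "\<And>v. continuous_on (ball 0 R) (d v)" "\<And>v w. continuous_on (ball 0 R) (dd v w)"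
    using C' Ck_on_imp_continuous_on by blast+
  note cont = ce[unfolded split_beta] cu[OF ch(1), unfolded split_beta] cu[OF ch(2), unfolded split_beta]
     cu[OF ch(3), unfolded split_beta]
  have norm_J: "norm (J x) = norm x" for x
    using skew[of x "J x"] JJ[of x] by (simp add: norm_eq_sqrt_inner)
  \<comment> \<open>The factor \<open>2 * R\<close> bounds \<open>|Re z| + |Im z|\<close> on the
    disc, the cost of multiplying by \<open>cnj z\<close>.\<close>
  have "w b arg = 0"
  proof (rule circle_unique_continuation[OF J skew _ _ aU(1) bU aU(2), of "2 * R * K" w ws wt wst])
    fix s t assume s: "s \<in> U"
    show "((\<lambda>s. w s t) has_vector_derivative ws s t) (at s within U)"
      unfolding w_def ws_def by (rule polar0) (rule inR[OF s])
    show "((\<lambda>t. w s t) has_vector_derivative wt s t) (at t within {0..2*pi})"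
      unfolding w_def wt_def by (rule polar0) (rule inR[OF s])
    show "((\<lambda>t. ws s t) has_vector_derivative wst s t) (at t within {0..2*pi})"
      unfolding ws_def wst_def
      by (rule has_vector_derivative_eq_rhs[OF has_vector_derivative_add
            [OF has_vector_derivative_scaleR[OF e_s(3) polar1(2)[OF inR[OF s]]]
                has_vector_derivative_scaleR[OF e_s(4) polar1(2)[OF inR[OF s]]]]])
         (simp add: algebra_simps)
    \<comment> \<open>\<open>wst\<close> was written down as the \<open>t\<close>-derivative of
      \<open>ws\<close>; that it is also the \<open>s\<close>-derivative of \<open>wt\<close> rests
      on the symmetry \<open>sym\<close> of second derivatives.\<close>
    show "((\<lambda>s. wt s t) has_vector_derivative wst s t) (at s within U)"
      unfolding wt_def wst_def
      by (rule has_vector_derivative_eq_rhs[OF has_vector_derivative_diff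
            [OF has_vector_derivative_scaleR[OF e_s(1) polar1(1)[OF inR[OF s]]]
                has_vector_derivative_scaleR[OF e_s(2) polar1(1)[OF inR[OF s]]]]])
         (simp add: algebra_simps sym[OF inR[OF s]])
    show "norm (ws s t + J (wt s t)) \<le> 2 * R * K * norm (w s t)"
    proof -
      let ?q = "d 1 (e s t) + J (d \<i> (e s t))"
      interpret J: bounded_linear J by (rule J)
      have "ws s t + J (wt s t) = Re (e s t) *\<^sub>R ?q - Im (e s t) *\<^sub>R J ?q"
        by (simp add: ws_def wt_def J.add J.diff J.scaleR JJ algebra_simps)
      also have "norm \<dots> \<le> \<bar>Re (e s t)\<bar> * norm ?q + \<bar>Im (e s t)\<bar> * norm ?q"
        by (rule order_trans[OF norm_triangle_ineq4]) (simp add: norm_J)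
      also have "\<dots> \<le> R * norm ?q + R * norm ?q"
        using inR[OF s, of t] abs_Re_le_cmod[of "e s t"] abs_Im_le_cmod[of "e s t"]
        by (intro add_mono mult_right_mono) auto
      also have "\<dots> = 2 * R * norm ?q" by simp
      also have "\<dots> \<le> 2 * R * (K * norm (w s t))"
        using bound[OF inR[OF s, of t]] R by (intro mult_left_mono) (auto simp: d_def w_def)
      finally show ?thesis by simp
    qed
  next
    show "continuous_on (U \<times> {0..2 * pi}) (\<lambda>(s, t). w s t)"
      unfolding w_def split_beta by (intro cont)
    show "continuous_on (U \<times> {0..2 * pi}) (\<lambda>(s, t). ws s t)"
      unfolding ws_def split_beta by (intro continuous_intros cont)
    show "continuous_on (U \<times> {0..2 * pi}) (\<lambda>(s, t). wt s t)"
      unfolding wt_def split_beta by (intro continuous_intros cont)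
    show "continuous_on (U \<times> {0..2 * pi}) (\<lambda>(s, t). wst s t)"
      unfolding wst_def split_beta by (intro continuous_intros cont)
  next
    have "e s (2*pi) = e s 0" for s by (simp add: complex_eq_iff eRe eIm)
    then show "w s (2*pi) = w s 0" "ws s (2*pi) = ws s 0" for s
      by (simp_all add: w_def ws_def)
  next
    fix t
    have "exp a \<le> exp (ln (r / 2))" unfolding exp_le_cancel_iff by (simp add: a_def)
    then have "e a t \<in> ball 0 r" using r by (simp add: norm_e)
    then show "w a t = 0" using zero by (simp add: w_def)
  qed (use arg K R in \<open>auto simp: U_def\<close>)
  then show ?thesis by (simp add: w_def zb[symmetric])
qed

section \<open>Wirtinger calculus in several variables\<close>

lemma complex_basis_expansion:
  fixes v :: "complex^'m"
  shows "v = (\<Sum>\<beta>\<in>UNIV. Re (v $ \<beta>) *\<^sub>R axis \<beta> 1 + Im (v $ \<beta>) *\<^sub>R axis \<beta> \<i>)"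
proof -
  have "(Re (v $ \<beta>) *\<^sub>R axis \<beta> 1 + Im (v $ \<beta>) *\<^sub>R axis \<beta> \<i>) $ i = (if \<beta> = i then v $ i else 0)" for \<beta> i
    by (simp add: axis_def complex_eq_iff)
  then show ?thesis by (simp add: vec_eq_iff sum.delta)
qed

lemma frechet_derivative_wirtinger:
  fixes u :: "complex^'m \<Rightarrow> complex"
  assumes "u differentiable (at z)"
  shows "frechet_derivative u (at z) v
    = (\<Sum>\<beta>\<in>UNIV. v $ \<beta> * dz \<beta> u z + cnj (v $ \<beta>) * dzbar \<beta> u z)"
proof -
  have lin: "linear (frechet_derivative u (at z))"
    using assms by (rule linear_frechet_derivative)
  have "frechet_derivative u (at z) v = frechet_derivative u (at z)
      (\<Sum>\<beta>\<in>UNIV. Re (v $ \<beta>) *\<^sub>R axis \<beta> 1 + Im (v $ \<beta>) *\<^sub>R axis \<beta> \<i>)"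
    by (simp flip: complex_basis_expansion)
  also have "\<dots> = (\<Sum>\<beta>\<in>UNIV. Re (v $ \<beta>) *\<^sub>R frechet_derivative u (at z) (axis \<beta> 1)
      + Im (v $ \<beta>) *\<^sub>R frechet_derivative u (at z) (axis \<beta> \<i>))"
    by (simp only: linear_sum[OF lin] linear_add[OF lin] linear_scale[OF lin] o_def)
  also have "\<dots> = (\<Sum>\<beta>\<in>UNIV. v $ \<beta> * dz \<beta> u z + cnj (v $ \<beta>) * dzbar \<beta> u z)"
    by (rule sum.cong) (auto simp: dz_def dzbar_def complex_eq_iff field_simps)
  finally show ?thesis .
qed

lemma frechet_derivative_vec_nth:
  assumes "(F has_derivative D) (at z)"
  shows "frechet_derivative (\<lambda>x. F x $ i) (at z) v = D v $ i" "(\<lambda>x. F x $ i) differentiable (at z)"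
proof -
  have D: "((\<lambda>x. F x $ i) has_derivative (\<lambda>v. D v $ i)) (at z)"
    by (rule bounded_linear.has_derivative[OF bounded_linear_vec_nth assms])
  then show "frechet_derivative (\<lambda>x. F x $ i) (at z) v = D v $ i"
    by (simp add: frechet_derivative_at[OF D, symmetric])
  show "(\<lambda>x. F x $ i) differentiable (at z)"
    using D by (auto simp: differentiable_def)
qed

lemma derivative_wirtinger_nth:
  fixes F :: "complex^'m \<Rightarrow> complex^'n"
  assumes "(F has_derivative D) (at z)"
  shows "D v $ i = (\<Sum>\<beta>\<in>UNIV. v $ \<beta> * dz \<beta> (\<lambda>x. F x $ i) z + cnj (v $ \<beta>) * dzbar \<beta> (\<lambda>x. F x $ i) z)"
  using frechet_derivative_wirtinger[OF frechet_derivative_vec_nth(2)[OF assms]]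
    frechet_derivative_vec_nth(1)[OF assms] by metis

lemma dz_eq_nth:
  assumes "(F has_derivative D) (at z)"
  shows "dz \<beta> (\<lambda>x. F x $ i) z = (D (axis \<beta> 1) $ i - \<i> * D (axis \<beta> \<i>) $ i) / 2"
    and "dzbar \<beta> (\<lambda>x. F x $ i) z = (D (axis \<beta> 1) $ i + \<i> * D (axis \<beta> \<i>) $ i) / 2"
  unfolding dz_def dzbar_def frechet_derivative_vec_nth(1)[OF assms] by simp_all

lemma axis_ii: "axis \<beta> \<i> = \<i> *s axis \<beta> (1::complex)"
  by (simp add: vec_eq_iff axis_def)

lemma complex_linear_iff_dzbar:
  fixes F :: "complex^'m \<Rightarrow> complex^'n"
  assumes "(F has_derivative D) (at z)"
  shows "(\<forall>c v. D (c *s v) = c *s D v) \<longleftrightarrow> (\<forall>\<beta> i. dzbar \<beta> (\<lambda>x. F x $ i) z = 0)"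
proof
  assume "\<forall>c v. D (c *s v) = c *s D v"
  then show "\<forall>\<beta> i. dzbar \<beta> (\<lambda>x. F x $ i) z = 0"
    by (simp add: dz_eq_nth[OF assms] axis_ii)
next
  assume "\<forall>\<beta> i. dzbar \<beta> (\<lambda>x. F x $ i) z = 0"
  then show "\<forall>c v. D (c *s v) = c *s D v"
    by (simp add: vec_eq_iff derivative_wirtinger_nth[OF assms] sum_distrib_left mult.assoc)
qed

lemma complex_antilinear_iff_dz:
  fixes F :: "complex^'m \<Rightarrow> complex^'n"
  assumes "(F has_derivative D) (at z)"
  shows "(\<forall>c v. D (c *s v) = cnj c *s D v) \<longleftrightarrow> (\<forall>\<beta> i. dz \<beta> (\<lambda>x. F x $ i) z = 0)"
proof
  assume "\<forall>c v. D (c *s v) = cnj c *s D v"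
  then show "\<forall>\<beta> i. dz \<beta> (\<lambda>x. F x $ i) z = 0"
    by (simp add: dz_eq_nth[OF assms] axis_ii)
next
  assume "\<forall>\<beta> i. dz \<beta> (\<lambda>x. F x $ i) z = 0"
  then show "\<forall>c v. D (c *s v) = cnj c *s D v"
    by (simp add: vec_eq_iff derivative_wirtinger_nth[OF assms] sum_distrib_left mult.assoc)
qed

section \<open>Rules for the Wirtinger operators\<close>

lemma wirtinger_cong:
  assumes "open S" "z \<in> S" "u differentiable (at z)" "\<And>x. x \<in> S \<Longrightarrow> u x = v x"
  shows "dz \<beta> u z = dz \<beta> v z" "dzbar \<beta> u z = dzbar \<beta> v z"
  using frechet_derivative_transform_within_open[OF assms(3,1,2,4)]
  by (simp_all add: dz_def dzbar_def)

lemma wirtinger_const: "dz \<beta> (\<lambda>x. c) z = 0" "dzbar \<beta> (\<lambda>x. c) z = 0"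
  by (simp_all add: dz_def dzbar_def)

lemma dzbar_mult:
  assumes "u differentiable (at z)" "v differentiable (at z)"
  shows "dzbar \<beta> (\<lambda>x. u x * v x) z = u z * dzbar \<beta> v z + dzbar \<beta> u z * v z"
proof -
  have D: "((\<lambda>x. u x * v x) has_derivative
      (\<lambda>h. u z * frechet_derivative v (at z) h + frechet_derivative u (at z) h * v z)) (at z)"
    using assms by (intro has_derivative_mult) (simp_all flip: frechet_derivative_works)
  show ?thesis
    by (simp add: dzbar_def frechet_derivative_at[OF D, symmetric] field_simps)
qed

lemma dzbar_sum:
  assumes "\<And>i. i \<in> I \<Longrightarrow> u i differentiable (at z)"
  shows "dzbar \<beta> (\<lambda>x. \<Sum>i\<in>I. u i x) z = (\<Sum>i\<in>I. dzbar \<beta> (u i) z)"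
proof -
  have D: "((\<lambda>x. \<Sum>i\<in>I. u i x) has_derivative
      (\<lambda>h. \<Sum>i\<in>I. frechet_derivative (u i) (at z) h)) (at z)"
    using assms by (intro has_derivative_sum) (simp flip: frechet_derivative_works)
  show ?thesis
    by (simp add: dzbar_def frechet_derivative_at[OF D, symmetric] sum.distrib
        sum_distrib_left flip: sum_divide_distrib)
qed

lemma dzbar_cnj:
  assumes "u differentiable (at z)"
  shows "dzbar \<beta> (\<lambda>x. cnj (u x)) z = cnj (dz \<beta> u z)"
proof -
  have D: "((\<lambda>x. cnj (u x)) has_derivative (\<lambda>h. cnj (frechet_derivative u (at z) h))) (at z)"
    using assms by (intro has_derivative_cnj) (simp flip: frechet_derivative_works)
  show ?thesis
    by (simp add: dzbar_def dz_def frechet_derivative_at[OF D, symmetric])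
qed

text \<open>\<open>h\<close> depends on \<open>F\<close> and on its conjugate; the factor
  \<open>cnj (dz \<beta> ...)\<close> is the \<open>dzbar\<close>-derivative of the conjugated
  component.\<close>

lemma dzbar_chain:
  fixes F :: "complex^'m \<Rightarrow> complex^'n" and h :: "complex^'n \<Rightarrow> complex"
  assumes F: "F differentiable (at z)" and h: "h differentiable (at (F z))"
  shows "dzbar \<beta> (\<lambda>x. h (F x)) z = (\<Sum>j\<in>UNIV. dz j h (F z) * dzbar \<beta> (\<lambda>x. F x $ j) z
      + dzbar j h (F z) * cnj (dz \<beta> (\<lambda>x. F x $ j) z))"
proof -
  obtain D where F': "(F has_derivative D) (at z)"
    using F by (auto simp: differentiable_def)
  have D: "((\<lambda>x. h (F x)) has_derivative (\<lambda>v. frechet_derivative h (at (F z)) (D v))) (at z)"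
    using h by (intro has_derivative_compose[OF F']) (simp flip: frechet_derivative_works)
  have "dzbar \<beta> (\<lambda>x. h (F x)) z = (frechet_derivative h (at (F z)) (D (axis \<beta> 1))
        + \<i> * frechet_derivative h (at (F z)) (D (axis \<beta> \<i>))) / 2"
    by (simp add: dzbar_def frechet_derivative_at[OF D, symmetric])
  also have "\<dots> = (\<Sum>j\<in>UNIV. dz j h (F z) * ((D (axis \<beta> 1) $ j + \<i> * D (axis \<beta> \<i>) $ j) / 2)
      + dzbar j h (F z) * ((cnj (D (axis \<beta> 1) $ j) + \<i> * cnj (D (axis \<beta> \<i>) $ j)) / 2))"
    unfolding frechet_derivative_wirtinger[OF h] sum_distrib_left sum.distrib[symmetric] sum_divide_distrib
    by (rule sum.cong) (auto simp: field_simps)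
  also have "\<dots> = (\<Sum>j\<in>UNIV. dz j h (F z) * dzbar \<beta> (\<lambda>x. F x $ j) z
      + dzbar j h (F z) * cnj (dz \<beta> (\<lambda>x. F x $ j) z))"
    by (simp add: dz_eq_nth[OF F'])
  finally show ?thesis .
qed

lemma wirtinger_commute:
  fixes u :: "complex^'m \<Rightarrow> complex"
  assumes S: "open S" "z \<in> S" and u: "smooth_on u S"
  shows "dz \<alpha> (dz \<beta> u) z = dz \<beta> (dz \<alpha> u) z"
    and "dz \<alpha> (dzbar \<beta> u) z = dzbar \<beta> (dz \<alpha> u) z"
    and "dzbar \<alpha> (dzbar \<beta> u) z = dzbar \<beta> (dzbar \<alpha> u) z"
proof -
  \<comment> \<open>Both operators belong to the family \<open>W c\<close>, with
    \<open>c = -\<i>\<close> and \<open>c = \<i>\<close>, so the three claims are a single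
    computation with the symmetric form \<open>dd\<close>.\<close>
  define W where "W c \<alpha> u x = (frechet_derivative u (at x) (axis \<alpha> 1) + c * frechet_derivative u (at x) (axis \<alpha> \<i>)) / 2"
    for c and \<alpha> :: 'm and u :: "complex^'m \<Rightarrow> complex" and x
  have W: "dz \<alpha> u = W (-\<i>) \<alpha> u" "dzbar \<alpha> u = W \<i> \<alpha> u" for \<alpha> u
    by (simp_all add: fun_eq_iff dz_def dzbar_def W_def)
  define dd where "dd v w = frechet_derivative (\<lambda>x. frechet_derivative u (at x) v) (at z) w" for v w
  have sym: "dd v w = dd w v" for v w
    unfolding dd_def using frechet_derivative_commute[OF smooth_on_Ck[OF u] S] .
  have WW: "W c \<alpha> (W d \<beta> u) z = (dd (axis \<beta> 1) (axis \<alpha> 1) + d * dd (axis \<beta> \<i>) (axis \<alpha> 1)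
      + c * (dd (axis \<beta> 1) (axis \<alpha> \<i>) + d * dd (axis \<beta> \<i>) (axis \<alpha> \<i>))) / 4" for c d \<alpha> \<beta>
  proof -
    have "((\<lambda>x. frechet_derivative u (at x) v) has_derivative dd v) (at z)" for v
      unfolding dd_def[abs_def] using smooth_on_has_derivative[OF smooth_on_frechet_derivative[OF u] S(2)] .
    then have D: "(W d \<beta> u has_derivative (\<lambda>w. (dd (axis \<beta> 1) w + d * dd (axis \<beta> \<i>) w) / 2)) (at z)"
      unfolding W_def[abs_def] by (auto intro!: derivative_eq_intros)
    show ?thesis
      unfolding W_def[of c \<alpha>] frechet_derivative_at[OF D, symmetric] by (simp add: field_simps)
  qed
  have "W c \<alpha> (W d \<beta> u) z = W d \<beta> (W c \<alpha> u) z" for c d \<alpha> \<beta>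
    unfolding WW sym[of "axis \<beta> 1" "axis \<alpha> 1"] sym[of "axis \<beta> 1" "axis \<alpha> \<i>"]
      sym[of "axis \<beta> \<i>" "axis \<alpha> 1"] sym[of "axis \<beta> \<i>" "axis \<alpha> \<i>"]
    by (simp add: algebra_simps)
  then show "dz \<alpha> (dz \<beta> u) z = dz \<beta> (dz \<alpha> u) z" "dz \<alpha> (dzbar \<beta> u) z = dzbar \<beta> (dz \<alpha> u) z"
    "dzbar \<alpha> (dzbar \<beta> u) z = dzbar \<beta> (dzbar \<alpha> u) z"
    unfolding W by auto
qed

lemma norm_vec_smult: "norm (c *s v) = norm c * norm (v :: complex^'n)"
  unfolding norm_vec_def by (simp add: norm_mult L2_set_right_distrib)

lemma bounded_linear_vec_smult: "bounded_linear (\<lambda>v::complex^'n. c *s v)"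
  by (rule bounded_linear_intro[where K = "norm c"])
     (simp_all add: norm_vec_smult vec_eq_iff algebra_simps)

text \<open>Each \<open>q\<close> is reached along its own complex line:
  \<open>u \<zeta> = \<Phi> (p + \<zeta> v)\<close> with \<open>v = q - p\<close> vanishes near 0
  and satisfies the one-variable estimate, and \<open>q\<close> corresponds to
  \<open>\<zeta> = 1\<close>.\<close>

lemma ball_unique_continuation:
  fixes \<Phi> :: "complex^'m \<Rightarrow> complex^'n"
  assumes sm: "smooth_on \<Phi> (ball p R)" and K: "K \<ge> 0"
    and bound: "\<And>z \<beta> i. z \<in> ball p R \<Longrightarrow> norm (dzbar \<beta> (\<lambda>x. \<Phi> x $ i) z) \<le> K * norm (\<Phi> z)"
    and r: "r > 0" and zero: "\<And>z. z \<in> ball p r \<Longrightarrow> \<Phi> z = 0" and q: "q \<in> ball p R"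
  shows "\<Phi> q = 0"
proof (cases "q = p")
  case True
  then show ?thesis using r zero by simp
next
  case False
  define v where "v = q - p"
  have v: "norm v > 0" "norm v < R" using False q by (auto simp: v_def dist_norm norm_minus_commute)
  define u where "u \<zeta> = \<Phi> (p + \<zeta> *s v)" for \<zeta> :: complex
  have bl: "bounded_linear (\<lambda>\<zeta>. \<zeta> *s v)"
    by (rule bounded_linear_intro[where K = "norm v"])
       (simp_all add: vec_eq_iff algebra_simps norm_vec_smult)
  have inb: "p + \<zeta> *s v \<in> ball p s" if "\<zeta> \<in> ball 0 (s / norm v)" for \<zeta> :: complex and s
    using that v by (simp add: dist_norm norm_vec_smult pos_less_divide_eq)
  \<comment> \<open>In the constant, the 2 turns \<open>dbar\<close> into
    \<open>\<partial>\<^sub>x + \<i> \<partial>\<^sub>y\<close>, the sum over \<open>\<beta>\<close>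
    comes from the chain rule along \<open>v\<close>, and \<open>CARD('n)\<close> passes from
    components to the norm of the vector.\<close>
  have "u 1 = 0"
  proof (rule disc_unique_continuation[where J = "\<lambda>x. \<i> *s x" and R = "R / norm v" and r = "r / norm v"
        and K = "(2 * real CARD('n) * (\<Sum>\<beta>\<in>UNIV. norm (v $ \<beta>))) * K"])
    show "Ck_on 2 u (ball 0 (R / norm v))"
      unfolding u_def using inb
      by (intro Ck_on_compose_affine[OF _ _ bl _ smooth_on_Ck[OF sm]]) auto
  next
    fix \<zeta> :: complex assume \<zeta>: "\<zeta> \<in> ball 0 (R / norm v)"
    let ?z = "p + \<zeta> *s v"
    note D = smooth_on_has_derivative[OF sm inb[OF \<zeta>]]
    have "((\<lambda>\<zeta>. p + \<zeta> *s v) has_derivative (\<lambda>\<zeta>. \<zeta> *s v)) (at \<zeta>)"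
      using bl by (auto intro!: derivative_eq_intros bounded_linear_imp_has_derivative)
    from has_derivative_compose[OF this D]
    have Du: "(u has_derivative (\<lambda>\<zeta>. frechet_derivative \<Phi> (at ?z) (\<zeta> *s v))) (at \<zeta>)"
      by (simp add: u_def[abs_def])
    let ?q = "frechet_derivative u (at \<zeta>) 1 + \<i> *s frechet_derivative u (at \<zeta>) \<i>"
    have q: "?q $ i = 2 * (\<Sum>\<beta>\<in>UNIV. cnj (v $ \<beta>) * dzbar \<beta> (\<lambda>x. \<Phi> x $ i) ?z)" for i
    proof -
      have "?q $ i = (\<Sum>\<beta>\<in>UNIV. v $ \<beta> * dz \<beta> (\<lambda>x. \<Phi> x $ i) ?z + cnj (v $ \<beta>) * dzbar \<beta> (\<lambda>x. \<Phi> x $ i) ?z)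
        + (\<Sum>\<beta>\<in>UNIV. \<i> * (\<i> * v $ \<beta> * dz \<beta> (\<lambda>x. \<Phi> x $ i) ?z + cnj (\<i> * v $ \<beta>) * dzbar \<beta> (\<lambda>x. \<Phi> x $ i) ?z))"
        by (simp add: frechet_derivative_at[OF Du, symmetric] derivative_wirtinger_nth[OF D] sum_distrib_left)
      also have "\<dots> = (\<Sum>\<beta>\<in>UNIV. 2 * (cnj (v $ \<beta>) * dzbar \<beta> (\<lambda>x. \<Phi> x $ i) ?z))"
        unfolding sum.distrib[symmetric] by (rule sum.cong) (auto simp: algebra_simps)
      finally show ?thesis by (simp add: sum_distrib_left)
    qed
    have "norm (?q $ i) \<le> 2 * (\<Sum>\<beta>\<in>UNIV. norm (v $ \<beta>)) * (K * norm (u \<zeta>))" for i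
    proof -
      have "norm (\<Sum>\<beta>\<in>UNIV. cnj (v $ \<beta>) * dzbar \<beta> (\<lambda>x. \<Phi> x $ i) ?z)
        \<le> (\<Sum>\<beta>\<in>UNIV. norm (v $ \<beta>) * (K * norm (u \<zeta>)))"
        using bound[OF inb[OF \<zeta>]]
        by (intro sum_norm_le) (auto simp: norm_mult u_def intro!: mult_left_mono)
      then show ?thesis
        unfolding q norm_mult by (simp only: sum_distrib_right mult.assoc) simp
    qed
    then have "(\<Sum>i\<in>UNIV. norm (?q $ i)) \<le> (\<Sum>i\<in>(UNIV::'n set). 2 * (\<Sum>\<beta>\<in>UNIV. norm (v $ \<beta>)) * (K * norm (u \<zeta>)))"
      by (rule sum_mono)
    moreover have "norm ?q \<le> (\<Sum>i\<in>UNIV. norm (?q $ i))"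
      unfolding norm_vec_def by (rule L2_set_le_sum) auto
    ultimately show "norm ?q \<le> 2 * real CARD('n) * (\<Sum>\<beta>\<in>UNIV. norm (v $ \<beta>)) * K * norm (u \<zeta>)"
      by (simp add: algebra_simps)
  next
    show "u \<zeta> = 0" if "\<zeta> \<in> ball 0 (r / norm v)" for \<zeta>
      using zero[OF inb[OF that]] by (simp add: u_def)
  next
    fix x y :: "complex^'n"
    have "(\<i> * a) \<bullet> b = - (a \<bullet> (\<i> * b))" for a b :: complex
      by (simp add: inner_complex_def)
    then show "(\<i> *s x) \<bullet> y = - (x \<bullet> (\<i> *s y))"
      by (simp add: inner_vec_def sum_negf)
    show "\<i> *s (\<i> *s x) = - x" by (simp add: vec_eq_iff)
  qed (use v r K in \<open>auto intro!: bounded_linear_vec_smult mult_nonneg_nonneg sum_nonneg\<close>)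
  then show ?thesis by (simp add: u_def v_def)
qed

section \<open>Algebra of the curvature identity\<close>

lemma sum_rotate4:
  "(\<Sum>i\<in>I. \<Sum>q\<in>Q. \<Sum>p\<in>P. \<Sum>k\<in>K. f i q p k) = (\<Sum>p\<in>P. \<Sum>q\<in>Q. \<Sum>k\<in>K. \<Sum>i\<in>I. f i q p k)"
proof -
  have "(\<Sum>i\<in>I. \<Sum>q\<in>Q. \<Sum>p\<in>P. \<Sum>k\<in>K. f i q p k) = (\<Sum>q\<in>Q. \<Sum>i\<in>I. \<Sum>p\<in>P. \<Sum>k\<in>K. f i q p k)"
    by (rule sum.swap)
  also have "\<dots> = (\<Sum>q\<in>Q. \<Sum>p\<in>P. \<Sum>i\<in>I. \<Sum>k\<in>K. f i q p k)"
    by (rule sum.cong[OF refl], rule sum.swap)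
  also have "\<dots> = (\<Sum>p\<in>P. \<Sum>q\<in>Q. \<Sum>i\<in>I. \<Sum>k\<in>K. f i q p k)"
    by (rule sum.swap)
  also have "\<dots> = (\<Sum>p\<in>P. \<Sum>q\<in>Q. \<Sum>k\<in>K. \<Sum>i\<in>I. f i q p k)"
    by (rule sum.cong[OF refl], rule sum.cong[OF refl], rule sum.swap)
  finally show ?thesis .
qed

text \<open>\<open>E \<alpha> \<beta>\<close> is the derivative in the direction of \<open>z-bar\<^sup>\<alpha>\<close> of the equation
  \<open>\<nabla>\<^bsub>\<beta>-bar\<^esub> \<partial>\<^sub>\<gamma> f = 0\<close> with the index lowered by the metric;
  skew-symmetrizing in \<open>\<alpha>, \<beta>\<close> leaves only curvature terms.\<close>

lemma lowered_equation_skew: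
  fixes G :: "'n::finite \<Rightarrow> complex" and XX :: "'m \<Rightarrow> 'm \<Rightarrow> 'n \<Rightarrow> complex"
    and E :: "'m \<Rightarrow> 'm \<Rightarrow> complex"
  assumes E: "\<And>\<alpha> \<beta>. E \<alpha> \<beta> = (\<Sum>i\<in>UNIV. G i * XX \<alpha> \<beta> i + (\<Sum>p\<in>UNIV. P p i * b \<alpha> p + Q p i * cnj (a \<alpha> p)) * X \<beta> i)
      + (\<Sum>j\<in>UNIV. \<Sum>k\<in>UNIV. P j k * (b \<beta> j * X \<alpha> k + Y \<alpha> \<beta> j * c k)
          + (\<Sum>p\<in>UNIV. PP p j k * b \<alpha> p + QP p j k * cnj (a \<alpha> p)) * (b \<beta> j * c k))"
    and E0: "\<And>\<alpha> \<beta>. E \<alpha> \<beta> = 0"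
    and XX: "\<And>\<alpha> \<beta> i. XX \<alpha> \<beta> i = XX \<beta> \<alpha> i" and Y: "\<And>\<alpha> \<beta> j. Y \<alpha> \<beta> j = Y \<beta> \<alpha> j"
    and PP: "\<And>p j k. PP p j k = PP j p k"
    and X: "\<And>\<beta> i. X \<beta> i = - (\<Sum>p\<in>UNIV. \<Sum>k\<in>UNIV. (\<Sum>m\<in>UNIV. h i m * P' p k m) * b \<beta> p * c k)"
    and R: "\<And>p q k. R p q k = - QP q p k + (\<Sum>i\<in>UNIV. \<Sum>m\<in>UNIV. h i m * P' p k m * Q q i)"
  shows "(\<Sum>p\<in>UNIV. \<Sum>q\<in>UNIV. \<Sum>k\<in>UNIV. R p q k * (b \<alpha> p * cnj (a \<beta> q) - b \<beta> p * cnj (a \<alpha> q)) * c k) = 0"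
proof -
  \<comment> \<open>The terms \<open>S\<close> are symmetric in \<open>\<alpha>, \<beta>\<close>,
    \<open>T1\<close> and \<open>T2\<close> are exchanged by the swap, and the terms
    \<open>N\<close>, which contain \<open>cnj (a ...)\<close>, are what survives
    skew-symmetrization.\<close>
  define S1 where "S1 \<alpha> \<beta> = (\<Sum>i\<in>UNIV. G i * XX \<alpha> \<beta> i)" for \<alpha> \<beta>
  define T1 where "T1 \<alpha> \<beta> = (\<Sum>i\<in>UNIV. \<Sum>p\<in>UNIV. P p i * b \<alpha> p * X \<beta> i)" for \<alpha> \<beta>
  define T2 where "T2 \<alpha> \<beta> = (\<Sum>j\<in>UNIV. \<Sum>k\<in>UNIV. P j k * b \<beta> j * X \<alpha> k)" for \<alpha> \<beta>
  define S3 where "S3 \<alpha> \<beta> = (\<Sum>j\<in>UNIV. \<Sum>k\<in>UNIV. P j k * Y \<alpha> \<beta> j * c k)" for \<alpha> \<beta>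
  define S4 where "S4 \<alpha> \<beta> = (\<Sum>j\<in>UNIV. \<Sum>k\<in>UNIV. \<Sum>p\<in>UNIV. PP p j k * b \<alpha> p * b \<beta> j * c k)" for \<alpha> \<beta>
  define N1 where "N1 \<alpha> \<beta> = (\<Sum>i\<in>UNIV. \<Sum>p\<in>UNIV. Q p i * cnj (a \<alpha> p) * X \<beta> i)" for \<alpha> \<beta>
  define N2 where "N2 \<alpha> \<beta> = (\<Sum>j\<in>UNIV. \<Sum>k\<in>UNIV. \<Sum>p\<in>UNIV. QP p j k * cnj (a \<alpha> p) * b \<beta> j * c k)" for \<alpha> \<beta>
  define C where "C \<alpha> \<beta> = (\<Sum>p\<in>UNIV. \<Sum>q\<in>UNIV. \<Sum>k\<in>UNIV. R p q k * (b \<beta> p * cnj (a \<alpha> q)) * c k)" for \<alpha> \<beta>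
  have dec: "E \<alpha> \<beta> = S1 \<alpha> \<beta> + T1 \<alpha> \<beta> + N1 \<alpha> \<beta> + T2 \<alpha> \<beta> + S3 \<alpha> \<beta> + S4 \<alpha> \<beta> + N2 \<alpha> \<beta>" for \<alpha> \<beta>
    unfolding E S1_def T1_def T2_def S3_def S4_def N1_def N2_def
    by (simp add: sum.distrib sum_distrib_left sum_distrib_right algebra_simps)
  have S1: "S1 \<alpha> \<beta> = S1 \<beta> \<alpha>" and S3: "S3 \<alpha> \<beta> = S3 \<beta> \<alpha>"
    unfolding S1_def S3_def by (simp_all add: XX[of \<alpha> \<beta>] Y[of \<alpha> \<beta>])
  have T2: "T2 \<alpha> \<beta> = T1 \<beta> \<alpha>" for \<alpha> \<beta>
    unfolding T1_def T2_def by (rule sum.swap)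
  have S4: "S4 \<alpha> \<beta> = S4 \<beta> \<alpha>"
  proof -
    have "S4 \<alpha> \<beta> = (\<Sum>j\<in>UNIV. \<Sum>p\<in>UNIV. \<Sum>k\<in>UNIV. PP p j k * b \<alpha> p * b \<beta> j * c k)"
      unfolding S4_def by (rule sum.cong[OF refl], rule sum.swap)
    also have "\<dots> = (\<Sum>p\<in>UNIV. \<Sum>j\<in>UNIV. \<Sum>k\<in>UNIV. PP p j k * b \<alpha> p * b \<beta> j * c k)"
      by (rule sum.swap)
    also have "\<dots> = (\<Sum>p\<in>UNIV. \<Sum>k\<in>UNIV. \<Sum>j\<in>UNIV. PP p j k * b \<alpha> p * b \<beta> j * c k)"
      by (rule sum.cong[OF refl], rule sum.swap)
    also have "\<dots> = S4 \<beta> \<alpha>"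
      unfolding S4_def by (intro sum.cong refl) (simp add: PP mult.commute mult.left_commute)
    finally show ?thesis .
  qed
  define Z where "Z = S1 \<beta> \<alpha> + S3 \<beta> \<alpha> + S4 \<beta> \<alpha> + T1 \<alpha> \<beta> + T1 \<beta> \<alpha>"
  have "N1 \<alpha> \<beta> + N2 \<alpha> \<beta> + Z = 0" "N1 \<beta> \<alpha> + N2 \<beta> \<alpha> + Z = 0"
    using dec[of \<alpha> \<beta>] dec[of \<beta> \<alpha>] unfolding E0 S1 S3 S4 T2 Z_def by (simp_all add: add_ac)
  then have "N1 \<alpha> \<beta> + N2 \<alpha> \<beta> = N1 \<beta> \<alpha> + N2 \<beta> \<alpha>"
    by (metis add_right_cancel)
  \<comment> \<open>The survivors form the curvature: \<open>N2\<close> supplies its second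
    derivatives of the metric, and \<open>N1\<close>, once \<open>X\<close> is inserted, its
    quadratic part.\<close>
  moreover have "N1 \<alpha> \<beta> + N2 \<alpha> \<beta> = - C \<alpha> \<beta>" for \<alpha> \<beta>
  proof -
    have "N1 \<alpha> \<beta> = - (\<Sum>i\<in>UNIV. \<Sum>q\<in>UNIV. \<Sum>p\<in>UNIV. \<Sum>k\<in>UNIV. (\<Sum>m\<in>UNIV. h i m * P' p k m * Q q i) * (b \<beta> p * cnj (a \<alpha> q)) * c k)"
      unfolding N1_def X by (simp add: sum_distrib_left sum_distrib_right sum_negf mult_ac)
    also have "\<dots> = - (\<Sum>p\<in>UNIV. \<Sum>q\<in>UNIV. \<Sum>k\<in>UNIV. \<Sum>i\<in>UNIV. (\<Sum>m\<in>UNIV. h i m * P' p k m * Q q i) * (b \<beta> p * cnj (a \<alpha> q)) * c k)"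
      by (subst sum_rotate4) (rule refl)
    finally have 1: "N1 \<alpha> \<beta> = - (\<Sum>p\<in>UNIV. \<Sum>q\<in>UNIV. \<Sum>k\<in>UNIV. (\<Sum>i\<in>UNIV. \<Sum>m\<in>UNIV. h i m * P' p k m * Q q i) * (b \<beta> p * cnj (a \<alpha> q)) * c k)"
      by (simp only: sum_distrib_right)
    have "N2 \<alpha> \<beta> = (\<Sum>p\<in>UNIV. \<Sum>q\<in>UNIV. \<Sum>k\<in>UNIV. QP q p k * (b \<beta> p * cnj (a \<alpha> q)) * c k)"
      unfolding N2_def by (rule sum.cong[OF refl], subst sum.swap) (simp add: mult_ac)
    with 1 show ?thesis
      unfolding C_def R by (simp add: algebra_simps sum.distrib sum_negf sum_subtractf)
  qed
  ultimately have "C \<alpha> \<beta> = C \<beta> \<alpha>" by simp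
  moreover have "(\<Sum>p\<in>UNIV. \<Sum>q\<in>UNIV. \<Sum>k\<in>UNIV. R p q k * (b \<alpha> p * cnj (a \<beta> q) - b \<beta> p * cnj (a \<alpha> q)) * c k)
      = C \<beta> \<alpha> - C \<alpha> \<beta>"
    unfolding C_def by (simp add: algebra_simps sum_subtractf)
  ultimately show ?thesis by simp
qed

section \<open>Linear algebra of the relation between the two halves of the differential\<close>

text \<open>Vanishing 2x2 minors mean rank one, so \<open>a = t \<otimes> p\<close>; dividing
  \<open>rel\<close> by a nonzero entry of \<open>a\<close> then gives \<open>b\<close> the
  conjugate coefficients. If \<open>a = 0\<close>, then \<open>rel\<close> is void and
  \<open>t\<close> is read off from \<open>b\<close>.\<close>

lemma parallel_families:
  fixes a b :: "'m \<Rightarrow> 'n \<Rightarrow> complex"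
  assumes rel: "\<And>\<alpha> \<beta> i j. b \<alpha> i * cnj (a \<beta> j) = b \<beta> i * cnj (a \<alpha> j)"
    and ma: "\<And>\<alpha> \<beta> i j. a \<alpha> i * a \<beta> j = a \<alpha> j * a \<beta> i"
    and mb: "\<And>\<alpha> \<beta> i j. b \<alpha> i * b \<beta> j = b \<alpha> j * b \<beta> i"
  obtains t p q where "\<And>\<alpha> i. a \<alpha> i = t \<alpha> * p i" "\<And>\<alpha> i. b \<alpha> i = cnj (t \<alpha>) * q i"
proof (cases "\<forall>\<alpha> i. a \<alpha> i = 0")
  case a0: True
  show ?thesis
  proof (cases "\<forall>\<alpha> i. b \<alpha> i = 0")
    case True
    then show ?thesis using a0 that[of "\<lambda>_. 0" "\<lambda>_. 0" "\<lambda>_. 0"] by simp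
  next
    case False
    then obtain \<beta> j where "b \<beta> j \<noteq> 0" by blast
    then show ?thesis
      using a0 mb by (intro that[of "\<lambda>\<alpha>. cnj (b \<alpha> j / b \<beta> j)" "\<lambda>_. 0" "\<lambda>i. b \<beta> i"]) (simp_all add: field_simps)
  qed
next
  case False
  then obtain \<beta> j where "a \<beta> j \<noteq> 0" by blast
  then show ?thesis
    using ma rel[of _ _ \<beta> j]
    by (intro that[of "\<lambda>\<alpha>. a \<alpha> j / a \<beta> j" "\<lambda>i. a \<beta> i" "\<lambda>i. b \<beta> i"]) (simp_all add: field_simps)
qed

text \<open>In the rank-one case \<open>D v = \<tau> p + cnj \<tau> q\<close> depends on
  \<open>v\<close> through one complex number \<open>\<tau>\<close>. Contrapositively, real rank at
  least 3 yields a nonzero 2x2 minor of \<open>a\<close> or of \<open>b\<close>.\<close>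

lemma dim_range_le_2:
  fixes D :: "complex^'m \<Rightarrow> complex^'n"
  assumes D: "\<And>v i. D v $ i = (\<Sum>\<beta>\<in>UNIV. v $ \<beta> * a \<beta> i + cnj (v $ \<beta>) * b \<beta> i)"
    and rel: "\<And>\<alpha> \<beta> i j. b \<alpha> i * cnj (a \<beta> j) = b \<beta> i * cnj (a \<alpha> j)"
    and ma: "\<And>\<alpha> \<beta> i j. a \<alpha> i * a \<beta> j = a \<alpha> j * a \<beta> i"
    and mb: "\<And>\<alpha> \<beta> i j. b \<alpha> i * b \<beta> j = b \<alpha> j * b \<beta> i"
  shows "dim (range D) \<le> 2"
proof -
  obtain t p q where a: "\<And>\<alpha> i. a \<alpha> i = t \<alpha> * p i" and b: "\<And>\<alpha> i. b \<alpha> i = cnj (t \<alpha>) * q i"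
    using parallel_families[of b a, OF rel ma mb] by blast
  \<comment> \<open>\<open>\<tau> p + cnj \<tau> q\<close> equals
    \<open>Re \<tau> (p + q) + Im \<tau> (\<i> (p - q))\<close>.\<close>
  define x where "x = (\<chi> i. p i + q i)"
  define y where "y = (\<chi> i. \<i> * (p i - q i))"
  have "D v \<in> span {x, y}" for v
  proof -
    define \<tau> where "\<tau> = (\<Sum>\<beta>\<in>UNIV. v $ \<beta> * t \<beta>)"
    have "D v $ i = \<tau> * p i + cnj \<tau> * q i" for i
      unfolding D a b \<tau>_def by (simp add: sum.distrib sum_distrib_right mult.assoc)
    then have "D v = Re \<tau> *\<^sub>R x + Im \<tau> *\<^sub>R y"
      by (simp add: vec_eq_iff x_def y_def complex_eq_iff algebra_simps)
    then show ?thesis by (simp add: span_add span_base span_scale)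
  qed
  then have "dim (range D) \<le> card {x, y}"
    by (intro dim_le_card) auto
  also have "\<dots> \<le> 2" by (simp add: card_insert_if)
  finally show ?thesis .
qed

text \<open>For fixed \<open>k\<close> the relation is a linear dependence between the conjugates of
  the vectors \<open>a \<alpha>\<close> and \<open>a \<beta>\<close>. These are independent, so
  \<open>b \<alpha> k = 0\<close>; comparing any \<open>\<gamma>\<close> with
  \<open>\<alpha>\<close> then kills \<open>b \<gamma> k\<close>, as \<open>a \<alpha>\<close> is
  nonzero.\<close>

lemma minor_nonzero_imp_zero:
  fixes a b :: "'m \<Rightarrow> 'n \<Rightarrow> complex"
  assumes rel: "\<And>\<alpha> \<beta> i j. b \<alpha> i * cnj (a \<beta> j) = b \<beta> i * cnj (a \<alpha> j)"
    and minor: "a \<alpha> i * a \<beta> j \<noteq> a \<alpha> j * a \<beta> i"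
  shows "b \<gamma> k = 0"
proof -
  have n: "cnj (a \<alpha> i) * cnj (a \<beta> j) - cnj (a \<alpha> j) * cnj (a \<beta> i) \<noteq> 0"
    using minor by (metis complex_cnj_cancel_iff complex_cnj_mult right_minus_eq)
  have "b \<alpha> k * (cnj (a \<alpha> i) * cnj (a \<beta> j) - cnj (a \<alpha> j) * cnj (a \<beta> i))
    = cnj (a \<alpha> i) * (b \<alpha> k * cnj (a \<beta> j)) - cnj (a \<alpha> j) * (b \<alpha> k * cnj (a \<beta> i))"
    by (simp add: right_diff_distrib mult_ac)
  also have "\<dots> = 0"
    unfolding rel[of \<alpha> k \<beta>] by (simp add: mult_ac)
  finally have ba: "b \<alpha> k = 0" using n by simp
  have "a \<alpha> i \<noteq> 0 \<or> a \<alpha> j \<noteq> 0" using minor by auto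
  then show ?thesis using ba rel[of \<gamma> k \<alpha> i] rel[of \<gamma> k \<alpha> j] by auto
qed

section \<open>Pluri-harmonic maps in local coordinates\<close>

lemma smooth_on_zero: "smooth_on (\<lambda>x. 0 :: 'b::real_normed_vector) (S :: 'a::euclidean_space set)"
proof -
  have "Ck_on k (\<lambda>x. 0 :: 'b) S" for k
    by (induction k) simp_all
  then show ?thesis by (simp add: smooth_on_def)
qed

lemma smooth_on_sum:
  assumes "open S" "finite I" "\<And>i. i \<in> I \<Longrightarrow> smooth_on (u i) S"
  shows "smooth_on (\<lambda>x. \<Sum>i\<in>I. u i x) S"
  using assms(2,3)
proof (induction I rule: finite_induct)
  case empty
  then show ?case by (simp add: smooth_on_zero)
next
  case (insert i I)
  then show ?case
    using smooth_on_add[OF assms(1), of "u i" "\<lambda>x. \<Sum>i\<in>I. u i x"] by simp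
qed

lemma smooth_on_vec_lambda:
  fixes u :: "'n::finite \<Rightarrow> 'a::euclidean_space \<Rightarrow> complex"
  assumes "open S" "\<And>i. smooth_on (u i) S"
  shows "smooth_on (\<lambda>x. \<chi> i. u i x) S"
proof -
  have bl: "bounded_linear (axis i :: complex \<Rightarrow> complex^'n)" for i
  proof (rule bounded_linear_intro[where K = 1])
    show "norm (axis i x :: complex^'n) \<le> norm x * 1" for x
      by (simp add: norm_eq_sqrt_inner inner_axis_axis)
  qed (simp_all add: vec_eq_iff axis_def)
  have "smooth_on (\<lambda>x. \<Sum>i\<in>UNIV. axis i (u i x)) S"
    by (rule smooth_on_sum[OF assms(1) _ smooth_on_bounded_linear[OF assms(1) bl assms(2)]]) simp
  moreover have "(\<Sum>i\<in>UNIV. axis i (u i x)) = (\<chi> i. u i x)" for x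
    by (simp add: vec_eq_iff axis_def)
  ultimately show ?thesis by simp
qed

lemma dzbar_add:
  assumes "u differentiable (at z)" "v differentiable (at z)"
  shows "dzbar \<beta> (\<lambda>x. u x + v x) z = dzbar \<beta> u z + dzbar \<beta> v z"
proof -
  have D: "((\<lambda>x. u x + v x) has_derivative
      (\<lambda>h. frechet_derivative u (at z) h + frechet_derivative v (at z) h)) (at z)"
    using assms by (intro has_derivative_add) (simp_all flip: frechet_derivative_works)
  show ?thesis
    by (simp add: dzbar_def frechet_derivative_at[OF D, symmetric] field_simps)
qed

lemma invertible_positive_definite:
  fixes M :: "complex^'n^'n"
  assumes "\<And>v. v \<noteq> 0 \<Longrightarrow> Re (herm M v v) > 0"
  shows "invertible (transpose M)"
proof -
  have "v = 0" if "M *v v = 0" for v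
  proof (rule ccontr)
    assume v: "v \<noteq> 0"
    \<comment> \<open>\<open>herm\<close> conjugates its second argument, so a kernel vector
      \<open>v\<close> has to be tested through its conjugate.\<close>
    define w where "w = (\<chi> i. cnj (v $ i))"
    have w: "w \<noteq> 0" using v by (auto simp: w_def vec_eq_iff)
    have "herm M w w = (\<Sum>i\<in>UNIV. w $ i * (M *v v) $ i)"
      by (simp add: herm_def w_def matrix_vector_mult_def sum_distrib_left mult_ac)
    also have "\<dots> = 0" using that by simp
    finally show False using assms[OF w] by simp
  qed
  then have "invertible M"
    by (simp add: invertible_left_inverse matrix_left_invertible_ker)
  then show ?thesis by (simp add: invertible_det_nz det_transpose)
qed

lemma matrix_inv_right:
  fixes M :: "'a::semiring_1^'n^'m"
  assumes "invertible M"
  shows "M ** matrix_inv M = mat 1"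
  using someI_ex[OF assms[unfolded invertible_def]] by (simp add: matrix_inv_def)

text \<open>By Cramer's rule the entries are quotients of determinants, hence of polynomials in the
  entries of \<open>M\<close>. Needed for the continuity of the Christoffel symbols.\<close>

lemma continuous_on_matrix_inv:
  fixes M :: "'a::topological_space \<Rightarrow> complex^'n^'n"
  assumes "\<And>i j. continuous_on S (\<lambda>x. M x $ i $ j)" and inv: "\<And>x. x \<in> S \<Longrightarrow> invertible (M x)"
  shows "continuous_on S (\<lambda>x. matrix_inv (M x) $ i $ j)"
proof -
  have det: "continuous_on S (\<lambda>x. det (N x))" if "\<And>i j. continuous_on S (\<lambda>x. N x $ i $ j)"
    for N :: "'a \<Rightarrow> complex^'n^'n"
    unfolding det_def
    by (intro continuous_on_sum continuous_on_mult continuous_on_const continuous_on_prod that)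
  have "continuous_on S (\<lambda>x. det (\<chi> r c. if c = i then axis j 1 $ r else M x $ r $ c) / det (M x))"
  proof (intro continuous_on_divide det)
    show "continuous_on S (\<lambda>x. (\<chi> r c. if c = i then axis j 1 $ r else M x $ r $ c) $ r $ c)" for r c
      using assms(1) by (cases "c = i") simp_all
  qed (use assms in \<open>auto simp: invertible_det_nz\<close>)
  moreover have "matrix_inv (M x) $ i $ j = det (\<chi> r c. if c = i then axis j 1 $ r else M x $ r $ c) / det (M x)"
    if x: "x \<in> S" for x
  proof -
    have "M x *v (matrix_inv (M x) *v axis j 1) = axis j 1"
      using matrix_inv_right[OF inv[OF x]] by (simp add: matrix_vector_mul_assoc)
    then have "matrix_inv (M x) *v axis j 1 = (\<chi> k. det (\<chi> r c. if c = k then axis j 1 $ r else M x $ r $ c) / det (M x))"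
      using cramer[of "M x"] inv[OF x] by (simp add: invertible_det_nz)
    moreover have "(matrix_inv (M x) *v axis j 1) $ i = matrix_inv (M x) $ i $ j"
      by (simp add: matrix_vector_mult_def axis_def if_distrib[where f = "\<lambda>x. _ * x"] cong: if_cong)
    ultimately show ?thesis by simp
  qed
  ultimately show ?thesis
    by (simp cong: continuous_on_cong)
qed

section \<open>A pluri-harmonic map read in one pair of charts\<close>

locale local_pluriharmonic =
  fixes S :: "(complex^'m) set" and T :: "(complex^'n) set" and F :: "complex^'m \<Rightarrow> complex^'n"
    and g :: "('b, 'n) metric" and d :: "('b, 'n) chart"
  assumes S: "open S" and T: "open T" and F: "smooth_on F S" and FS: "\<And>z. z \<in> S \<Longrightarrow> F z \<in> T"
    and g: "smooth_on (g d) T"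
    and positive: "\<And>w v. w \<in> T \<Longrightarrow> v \<noteq> 0 \<Longrightarrow> Re (herm (g d w) v v) > 0"
    and pluriharmonic: "\<And>z \<alpha> \<beta> i. z \<in> S \<Longrightarrow> dz \<alpha> (dzbar \<beta> (\<lambda>x. F x $ i)) z
          + (\<Sum>j\<in>UNIV. \<Sum>k\<in>UNIV. christoffel g d (F z) i j k
               * dzbar \<beta> (\<lambda>x. F x $ j) z * dz \<alpha> (\<lambda>x. F x $ k) z) = 0"
    and negative: "\<And>w A B C D. w \<in> T \<Longrightarrow> siu_matrix A B C D \<noteq> 0 \<Longrightarrow>
        Re (\<Sum>i\<in>UNIV. \<Sum>j\<in>UNIV. \<Sum>k\<in>UNIV. \<Sum>l\<in>UNIV.
              curvature g d w i j k l
              * siu_matrix A B C D $ i $ j * cnj (siu_matrix A B C D $ l $ k)) < 0"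
begin

definition a :: "'m \<Rightarrow> 'n \<Rightarrow> complex^'m \<Rightarrow> complex" where
  "a \<alpha> i = dz \<alpha> (\<lambda>x. F x $ i)"

definition b :: "'m \<Rightarrow> 'n \<Rightarrow> complex^'m \<Rightarrow> complex" where
  "b \<beta> i = dzbar \<beta> (\<lambda>x. F x $ i)"

definition gc :: "'n \<Rightarrow> 'n \<Rightarrow> complex^'n \<Rightarrow> complex" where
  "gc k l = (\<lambda>w. g d w $ k $ l)"

lemma smooth_F: "smooth_on (\<lambda>x. F x $ i) S"
  by (rule smooth_on_bounded_linear[OF S bounded_linear_vec_nth F])

lemma smooth_a: "smooth_on (a \<alpha> i) S" and smooth_b: "smooth_on (b \<alpha> i) S"
  unfolding a_def b_def by (intro smooth_on_dz S smooth_F)+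

lemma smooth_gc: "smooth_on (gc k l) T"
  unfolding gc_def
  by (intro smooth_on_bounded_linear[OF T bounded_linear_vec_nth]
      smooth_on_bounded_linear[OF T bounded_linear_vec_nth] g)

lemma F_gc_differentiable:
  assumes "smooth_on h T" "z \<in> S"
  shows "(\<lambda>x. h (F x)) differentiable (at z)"
  using differentiable_chain_at[of F z h] smooth_on_differentiable[OF F assms(2)]
    smooth_on_differentiable[OF assms(1) FS[OF assms(2)]] by (simp add: o_def)

lemma dz_b:
  assumes "z \<in> S"
  shows "dz \<alpha> (b \<beta> i) z = - (\<Sum>j\<in>UNIV. \<Sum>k\<in>UNIV. christoffel g d (F z) i j k * b \<beta> j z * a \<alpha> k z)"
  using pluriharmonic[OF assms, of \<alpha> \<beta> i] by (simp add: a_def b_def add_eq_0_iff)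

text \<open>Commuting the derivatives gives the right-hand side of \<open>dz_b\<close> again. There
  it is read as linear in \<open>b\<close> with coefficients from \<open>a\<close>, here as linear
  in \<open>a\<close> with coefficients from \<open>b\<close>; these are the two systems behind
  unique continuation.\<close>

lemma dzbar_a:
  assumes "z \<in> S"
  shows "dzbar \<beta> (a \<alpha> i) z = - (\<Sum>j\<in>UNIV. \<Sum>k\<in>UNIV. christoffel g d (F z) i j k * b \<beta> j z * a \<alpha> k z)"
  using dz_b[OF assms, of \<alpha> \<beta> i] wirtinger_commute(2)[OF S assms smooth_F, of \<alpha> \<beta> i]
  by (simp add: a_def b_def)

lemma invertible_g: "w \<in> T \<Longrightarrow> invertible (transpose (g d w))"
  using positive by (intro invertible_positive_definite)

lemma gc_ginv:
  assumes "w \<in> T"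
  shows "(\<Sum>i\<in>UNIV. gc i l w * ginv g d w $ i $ m) = (if m = l then 1 else 0)"
proof -
  have "(transpose (g d w) ** ginv g d w) $ l $ m = mat 1 $ l $ m"
    using matrix_inv_right[OF invertible_g[OF assms]] by (simp add: ginv_def)
  then show ?thesis
    by (simp add: matrix_matrix_mult_def transpose_def gc_def mat_def eq_commute)
qed

text \<open>Contracting \<open>dzbar_a\<close> with \<open>g\<close> cancels the inverse metric
  inside the Christoffel symbols, so that differentiating once more produces only derivatives of the
  metric components themselves.\<close>

lemma lowered_equation:
  assumes z: "z \<in> S"
  shows "(\<Sum>i\<in>UNIV. gc i l (F z) * dzbar \<beta> (a \<gamma> i) z)
    + (\<Sum>j\<in>UNIV. \<Sum>k\<in>UNIV. dz j (gc k l) (F z) * (b \<beta> j z * a \<gamma> k z)) = 0"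
proof -
  have "(\<Sum>i\<in>UNIV. gc i l (F z) * (\<Sum>j\<in>UNIV. \<Sum>k\<in>UNIV. christoffel g d (F z) i j k * b \<beta> j z * a \<gamma> k z))
     = (\<Sum>i\<in>UNIV. \<Sum>j\<in>UNIV. \<Sum>k\<in>UNIV. \<Sum>m\<in>UNIV. gc i l (F z) * ginv g d (F z) $ i $ m
           * (dz j (gc k m) (F z) * (b \<beta> j z * a \<gamma> k z)))"
    by (simp add: christoffel_def gc_def sum_distrib_left sum_distrib_right mult.assoc)
  \<comment> \<open>Brings the sum over \<open>i\<close> innermost, where \<open>gc_ginv\<close>
    collapses it to a Kronecker delta.\<close>
  also have "\<dots> = (\<Sum>k\<in>UNIV. \<Sum>j\<in>UNIV. \<Sum>m\<in>UNIV. \<Sum>i\<in>UNIV. gc i l (F z) * ginv g d (F z) $ i $ m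
           * (dz j (gc k m) (F z) * (b \<beta> j z * a \<gamma> k z)))"
    by (rule sum_rotate4)
  also have "\<dots> = (\<Sum>k\<in>UNIV. \<Sum>j\<in>UNIV. \<Sum>m\<in>UNIV. (if m = l then 1 else 0)
           * (dz j (gc k m) (F z) * (b \<beta> j z * a \<gamma> k z)))"
    by (simp only: sum_distrib_right[symmetric] gc_ginv[OF FS[OF z]])
  also have "\<dots> = (\<Sum>k\<in>UNIV. \<Sum>j\<in>UNIV. dz j (gc k l) (F z) * (b \<beta> j z * a \<gamma> k z))"
    by (simp add: if_distrib[where f = "\<lambda>x. x * _"] cong: if_cong)
  also have "\<dots> = (\<Sum>j\<in>UNIV. \<Sum>k\<in>UNIV. dz j (gc k l) (F z) * (b \<beta> j z * a \<gamma> k z))"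
    by (rule sum.swap)
  finally show ?thesis
    by (simp add: dzbar_a[OF z] sum_negf)
qed

lemma curvature_identity:
  assumes z: "z \<in> S"
  shows "(\<Sum>p\<in>UNIV. \<Sum>q\<in>UNIV. \<Sum>k\<in>UNIV. curvature g d (F z) p q k l
      * (b \<alpha> p z * cnj (a \<beta> q z) - b \<beta> p z * cnj (a \<alpha> q z)) * a \<gamma> k z) = 0"
proof (rule lowered_equation_skew)
  \<comment> \<open>The lowered equation as a function of the point. It vanishes on the whole open
    set \<open>S\<close>, so its derivative at \<open>z\<close> vanishes too.\<close>
  define E where "E \<beta> x = (\<Sum>i\<in>UNIV. gc i l (F x) * dzbar \<beta> (a \<gamma> i) x)
    + (\<Sum>j\<in>UNIV. \<Sum>k\<in>UNIV. dz j (gc k l) (F x) * (b \<beta> j x * a \<gamma> k x))" for \<beta> x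
  have diffs: "a \<alpha> i differentiable (at z)" "b \<alpha> i differentiable (at z)"
    "dzbar \<beta> (a \<alpha> i) differentiable (at z)" for \<alpha> \<beta> i
    by (intro smooth_on_differentiable[OF _ z] smooth_a smooth_b smooth_on_dz S)+
  have diffg: "(\<lambda>x. gc i k (F x)) differentiable (at z)" "(\<lambda>x. dz j (gc i k) (F x)) differentiable (at z)"
    for i j k
    by (intro F_gc_differentiable[OF _ z] smooth_gc smooth_on_dz T)+
  have chain: "dzbar \<beta> (\<lambda>x. h (F x)) z = (\<Sum>p\<in>UNIV. dz p h (F z) * b \<beta> p z + dzbar p h (F z) * cnj (a \<beta> p z))"
    if "smooth_on h T" for h \<beta>
    using dzbar_chain[OF smooth_on_differentiable[OF F z] smooth_on_differentiable[OF that FS[OF z]]]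
    by (simp add: a_def b_def)
  show "dzbar \<alpha> (E \<beta>) z = (\<Sum>i\<in>UNIV. gc i l (F z) * dzbar \<alpha> (dzbar \<beta> (a \<gamma> i)) z
        + (\<Sum>p\<in>UNIV. dz p (gc i l) (F z) * b \<alpha> p z + dzbar p (gc i l) (F z) * cnj (a \<alpha> p z)) * dzbar \<beta> (a \<gamma> i) z)
      + (\<Sum>j\<in>UNIV. \<Sum>k\<in>UNIV. dz j (gc k l) (F z) * (b \<beta> j z * dzbar \<alpha> (a \<gamma> k) z + dzbar \<alpha> (b \<beta> j) z * a \<gamma> k z)
          + (\<Sum>p\<in>UNIV. dz p (dz j (gc k l)) (F z) * b \<alpha> p z + dzbar p (dz j (gc k l)) (F z) * cnj (a \<alpha> p z)) * (b \<beta> j z * a \<gamma> k z))"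
    for \<alpha> \<beta>
  proof -
    have "dzbar \<alpha> (\<lambda>x. gc i l (F x) * dzbar \<beta> (a \<gamma> i) x) z = gc i l (F z) * dzbar \<alpha> (dzbar \<beta> (a \<gamma> i)) z
        + (\<Sum>p\<in>UNIV. dz p (gc i l) (F z) * b \<alpha> p z + dzbar p (gc i l) (F z) * cnj (a \<alpha> p z)) * dzbar \<beta> (a \<gamma> i) z" for i
      by (subst dzbar_mult) (simp_all add: diffs diffg chain[OF smooth_gc])
    moreover have "dzbar \<alpha> (\<lambda>x. dz j (gc k l) (F x) * (b \<beta> j x * a \<gamma> k x)) z =
        dz j (gc k l) (F z) * (b \<beta> j z * dzbar \<alpha> (a \<gamma> k) z + dzbar \<alpha> (b \<beta> j) z * a \<gamma> k z)
          + (\<Sum>p\<in>UNIV. dz p (dz j (gc k l)) (F z) * b \<alpha> p z + dzbar p (dz j (gc k l)) (F z) * cnj (a \<alpha> p z)) * (b \<beta> j z * a \<gamma> k z)"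
      for j k
      by (subst dzbar_mult, simp_all add: diffs diffg chain[OF smooth_on_dz(1)[OF T smooth_gc]])
         (subst dzbar_mult, simp_all add: diffs)
    moreover have "dzbar \<alpha> (E \<beta>) z = (\<Sum>i\<in>UNIV. dzbar \<alpha> (\<lambda>x. gc i l (F x) * dzbar \<beta> (a \<gamma> i) x) z)
        + (\<Sum>j\<in>UNIV. \<Sum>k\<in>UNIV. dzbar \<alpha> (\<lambda>x. dz j (gc k l) (F x) * (b \<beta> j x * a \<gamma> k x)) z)"
    proof -
      have d1: "(\<lambda>x. gc i l (F x) * dzbar \<beta> (a \<gamma> i) x) differentiable (at z)" for i
        by (intro differentiable_mult diffs diffg)
      have d2: "(\<lambda>x. dz j (gc k l) (F x) * (b \<beta> j x * a \<gamma> k x)) differentiable (at z)" for j k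
        by (intro differentiable_mult diffs diffg)
      show ?thesis
        unfolding E_def
        by (simp add: dzbar_add dzbar_sum differentiable_sum d1 d2)
    qed
    ultimately show ?thesis by simp
  qed
  show "dzbar \<alpha> (E \<beta>) z = 0" for \<alpha> \<beta>
  proof -
    have "dzbar \<alpha> (\<lambda>x. 0) z = dzbar \<alpha> (E \<beta>) z"
      by (rule wirtinger_cong(2)[OF S z]) (simp_all add: E_def lowered_equation)
    then show ?thesis by (simp add: wirtinger_const)
  qed
  show "dzbar \<alpha> (dzbar \<beta> (a \<gamma> i)) z = dzbar \<beta> (dzbar \<alpha> (a \<gamma> i)) z" for \<alpha> \<beta> i
    by (rule wirtinger_commute(3)[OF S z smooth_a])
  show "dzbar \<alpha> (b \<beta> j) z = dzbar \<beta> (b \<alpha> j) z" for \<alpha> \<beta> j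
    unfolding b_def by (rule wirtinger_commute(3)[OF S z smooth_F])
  show "dz p (dz j (gc k l)) (F z) = dz j (dz p (gc k l)) (F z)" for p j k
    by (rule wirtinger_commute(1)[OF T FS[OF z] smooth_gc])
  show "dzbar \<beta> (a \<gamma> i) z = - (\<Sum>p\<in>UNIV. \<Sum>k\<in>UNIV. (\<Sum>m\<in>UNIV. ginv g d (F z) $ i $ m * dz p (gc k m) (F z)) * b \<beta> p z * a \<gamma> k z)" for \<beta> i
    by (simp add: dzbar_a[OF z] christoffel_def gc_def)
  show "curvature g d (F z) p q k l = - dzbar q (dz p (gc k l)) (F z)
      + (\<Sum>i\<in>UNIV. \<Sum>m\<in>UNIV. ginv g d (F z) $ i $ m * dz p (gc k m) (F z) * dzbar q (gc i l) (F z))" for p q k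
    using wirtinger_commute(2)[OF T FS[OF z] smooth_gc, of p q k l]
    by (simp add: curvature_def gc_def)
qed

text \<open>Take \<open>A = b \<alpha>\<close>, \<open>B = a \<beta>\<close>,
  \<open>C = b \<beta>\<close>, \<open>D = a \<alpha>\<close> in Siu's condition. The conjugated
  factor is \<open>cnj (b \<alpha> l) * a \<beta> k - cnj (b \<beta> l) * a \<alpha> k\<close>, so
  the sum over \<open>k\<close> reproduces \<open>curvature_identity\<close> with
  \<open>\<gamma> = \<beta>\<close> and \<open>\<gamma> = \<alpha>\<close>. The whole expression is
  zero, which negativity permits only for the zero matrix.\<close>

lemma derivative_relation:
  assumes z: "z \<in> S"
  shows "b \<alpha> i z * cnj (a \<beta> j z) = b \<beta> i z * cnj (a \<alpha> j z)"
proof -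
  let ?W = "siu_matrix (\<chi> i. b \<alpha> i z) (\<chi> j. a \<beta> j z) (\<chi> i. b \<beta> i z) (\<chi> j. a \<alpha> j z)"
  define W where "W p q = b \<alpha> p z * cnj (a \<beta> q z) - b \<beta> p z * cnj (a \<alpha> q z)" for p q
  have W: "?W $ p $ q = W p q" for p q by (simp add: siu_matrix_def W_def)
  define I where "I l \<gamma> = (\<Sum>p\<in>UNIV. \<Sum>q\<in>UNIV. \<Sum>k\<in>UNIV. curvature g d (F z) p q k l * W p q * a \<gamma> k z)" for l \<gamma>
  have I: "I l \<gamma> = 0" for l \<gamma>
    using curvature_identity[OF z, of l \<alpha> \<beta> \<gamma>] by (simp add: I_def W_def)
  have "(\<Sum>i\<in>UNIV. \<Sum>j\<in>UNIV. \<Sum>k\<in>UNIV. \<Sum>l\<in>UNIV. curvature g d (F z) i j k l * W i j * cnj (W l k))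
    = (\<Sum>k\<in>UNIV. \<Sum>j\<in>UNIV. \<Sum>l\<in>UNIV. \<Sum>i\<in>UNIV. curvature g d (F z) i j k l * W i j * cnj (W l k))"
    by (rule sum_rotate4)
  also have "\<dots> = (\<Sum>l\<in>UNIV. \<Sum>j\<in>UNIV. \<Sum>i\<in>UNIV. \<Sum>k\<in>UNIV. curvature g d (F z) i j k l * W i j * cnj (W l k))"
    by (rule sum_rotate4)
  also have "\<dots> = (\<Sum>l\<in>UNIV. \<Sum>i\<in>UNIV. \<Sum>j\<in>UNIV. \<Sum>k\<in>UNIV. curvature g d (F z) i j k l * W i j * cnj (W l k))"
    by (rule sum.cong[OF refl], rule sum.swap)
  also have "\<dots> = (\<Sum>l\<in>UNIV. cnj (b \<alpha> l z) * I l \<beta> - cnj (b \<beta> l z) * I l \<alpha>)"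
    unfolding I_def W_def[of _ "_ :: 'n", symmetric]
    by (rule sum.cong[OF refl])
       (simp add: sum_distrib_left sum_subtractf[symmetric] W_def algebra_simps)
  also have "\<dots> = 0" by (simp add: I)
  finally have "?W = 0"
    using negative[OF FS[OF z], of "\<chi> i. b \<alpha> i z" "\<chi> j. a \<beta> j z" "\<chi> i. b \<beta> i z" "\<chi> j. a \<alpha> j z"]
    unfolding W by auto
  then have "W i j = 0" by (metis W zero_index)
  then show ?thesis by (simp add: W_def)
qed

end

section \<open>From the rank condition to complex linearity or antilinearity of the
  differential\<close>

text \<open>With \<open>\<sigma>\<close> the identity or \<open>cnj\<close> this expresses the
  holomorphic or the antiholomorphic alternative, so that both share one global argument.\<close>

definition linear_over :: "(complex \<Rightarrow> complex) \<Rightarrow> (complex^'m \<Rightarrow> complex^'n) \<Rightarrow> bool" where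
  "linear_over \<sigma> D \<longleftrightarrow> (\<forall>c v. D (c *s v) = \<sigma> c *s D v)"

context local_pluriharmonic
begin

lemma F_derivative: "z \<in> S \<Longrightarrow> (F has_derivative frechet_derivative F (at z)) (at z)"
  by (rule smooth_on_has_derivative[OF F])

lemma linear_over_id_iff:
  "z \<in> S \<Longrightarrow> linear_over (\<lambda>c. c) (frechet_derivative F (at z)) \<longleftrightarrow> (\<forall>\<beta> i. b \<beta> i z = 0)"
  using complex_linear_iff_dzbar[OF F_derivative] by (simp add: linear_over_def b_def)

lemma linear_over_cnj_iff:
  "z \<in> S \<Longrightarrow> linear_over cnj (frechet_derivative F (at z)) \<longleftrightarrow> (\<forall>\<beta> i. a \<beta> i z = 0)"
  using complex_antilinear_iff_dz[OF F_derivative] by (simp add: linear_over_def a_def)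

lemma minor_nonzero_near:
  assumes u: "\<And>\<alpha> i. continuous_on S (u \<alpha> i)" and z: "z \<in> S"
    and minor: "u \<alpha> i z * u \<beta> j z \<noteq> u \<alpha> j z * (u \<beta> i z :: complex)"
  obtains r where "r > 0" "ball z r \<subseteq> S" "\<And>x. x \<in> ball z r \<Longrightarrow> u \<alpha> i x * u \<beta> j x \<noteq> u \<alpha> j x * u \<beta> i x"
proof -
  define h where "h x = u \<alpha> i x * u \<beta> j x - u \<alpha> j x * u \<beta> i x" for x
  have "continuous_on S h"
    unfolding h_def by (intro continuous_intros u)
  then have "open (S \<inter> h -` (- {0}))"
    by (intro continuous_open_preimage S) auto
  moreover have "z \<in> S \<inter> h -` (- {0})"
    using z minor by (simp add: h_def)
  ultimately obtain r where "r > 0" "ball z r \<subseteq> S \<inter> h -` (- {0})"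
    using openE by blast
  then show ?thesis
    by (intro that[of r]) (auto simp: h_def)
qed

lemma rank_ge_3_imp_linear_near:
  assumes z: "z \<in> S" and rank: "dim (range (frechet_derivative F (at z))) \<ge> 3"
  obtains r \<sigma> where "r > 0" "\<sigma> = (\<lambda>c. c) \<or> \<sigma> = cnj" "ball z r \<subseteq> S"
    "\<And>x. x \<in> ball z r \<Longrightarrow> linear_over \<sigma> (frechet_derivative F (at x))"
proof -
  note rel = derivative_relation
  \<comment> \<open>Conjugation exchanges the roles of \<open>a\<close> and \<open>b\<close>, so
    that \<open>minor_nonzero_imp_zero\<close> also covers a nonzero minor of
    \<open>b\<close>.\<close>
  have rel': "a \<beta> j x * cnj (b \<alpha> i x) = a \<alpha> j x * cnj (b \<beta> i x)" if "x \<in> S" for x \<alpha> \<beta> i j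
    using arg_cong[OF rel[OF that, of \<alpha> i \<beta> j], of cnj] by (simp add: mult.commute)
  consider (a) \<alpha> \<beta> i j where "a \<alpha> i z * a \<beta> j z \<noteq> a \<alpha> j z * a \<beta> i z"
    | (b) \<alpha> \<beta> i j where "b \<alpha> i z * b \<beta> j z \<noteq> b \<alpha> j z * b \<beta> i z"
  proof (rule ccontr)
    assume n: "\<not> thesis"
    have "dim (range (frechet_derivative F (at z))) \<le> 2"
    proof (rule dim_range_le_2)
      show "frechet_derivative F (at z) v $ i = (\<Sum>\<beta>\<in>UNIV. v $ \<beta> * a \<beta> i z + cnj (v $ \<beta>) * b \<beta> i z)" for v i
        unfolding a_def b_def by (rule derivative_wirtinger_nth[OF F_derivative[OF z]])
    qed (use n that rel[OF z] in blast)+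
    then show False using rank by simp
  qed
  then show ?thesis
  proof cases
    case a
    from minor_nonzero_near[where u = "local.a", OF smooth_on_continuous_on[OF smooth_a] z a]
    obtain r where r: "r > 0" "ball z r \<subseteq> S"
      and nz: "\<And>x. x \<in> ball z r \<Longrightarrow> local.a \<alpha> i x * local.a \<beta> j x \<noteq> local.a \<alpha> j x * local.a \<beta> i x" by blast
    have "linear_over (\<lambda>c. c) (frechet_derivative F (at x))" if x: "x \<in> ball z r" for x
    proof -
      have xS: "x \<in> S" using r x by blast
      show ?thesis
        using minor_nonzero_imp_zero[of "\<lambda>\<beta> i. local.b \<beta> i x" "\<lambda>\<beta> i. local.a \<beta> i x", OF rel[OF xS] nz[OF x]]
        by (simp add: linear_over_id_iff[OF xS])
    qed
    with r show ?thesis by (intro that[of r "\<lambda>c. c"]) auto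
  next
    case b
    from minor_nonzero_near[where u = "local.b", OF smooth_on_continuous_on[OF smooth_b] z b]
    obtain r where r: "r > 0" "ball z r \<subseteq> S"
      and nz: "\<And>x. x \<in> ball z r \<Longrightarrow> local.b \<alpha> i x * local.b \<beta> j x \<noteq> local.b \<alpha> j x * local.b \<beta> i x" by blast
    have "linear_over cnj (frechet_derivative F (at x))" if x: "x \<in> ball z r" for x
    proof -
      have xS: "x \<in> S" using r x by blast
      show ?thesis
        using minor_nonzero_imp_zero[of "\<lambda>\<beta> i. local.a \<beta> i x" "\<lambda>\<beta> i. local.b \<beta> i x", OF rel'[OF xS] nz[OF x]]
        by (simp add: linear_over_cnj_iff[OF xS])
    qed
    with r show ?thesis by (intro that[of r cnj]) auto
  qed
qed

lemma continuous_on_christoffel: "continuous_on S (\<lambda>x. christoffel g d (F x) i j k)"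
proof -
  have "continuous_on T (\<lambda>w. ginv g d w $ i $ l)" for l
    unfolding ginv_def
  proof (rule continuous_on_matrix_inv)
    show "continuous_on T (\<lambda>w. transpose (g d w) $ i $ j)" for i j
      using smooth_on_continuous_on[OF smooth_gc[of j i]] by (simp add: transpose_def gc_def)
  qed (rule invertible_g)
  moreover have "continuous_on T (dz j (gc k l))" for l
    by (intro smooth_on_continuous_on smooth_on_dz T smooth_gc)
  ultimately have "continuous_on T (\<lambda>w. christoffel g d w i j k)"
    unfolding christoffel_def gc_def by (intro continuous_on_sum continuous_on_mult)
  then show ?thesis
    by (rule continuous_on_compose2[OF _ smooth_on_continuous_on[OF F]]) (use FS in auto)
qed

text \<open>A common majorant for the coefficients of both systems: Christoffel symbols times
  \<open>b\<close> in the system for \<open>a\<close>, times \<open>a\<close> in the system for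
  \<open>b\<close>.\<close>

definition bnd :: "'m \<Rightarrow> 'n \<Rightarrow> complex^'m \<Rightarrow> real" where
  "bnd \<beta> i x = (\<Sum>j\<in>UNIV. \<Sum>k\<in>UNIV. norm (christoffel g d (F x) i j k) * (norm (a \<beta> k x) + norm (b \<beta> j x)))"

lemma bnd_bounded:
  assumes "compact C" "C \<subseteq> S"
  obtains K where "K \<ge> 0" "\<And>x \<beta> i. x \<in> C \<Longrightarrow> bnd \<beta> i x \<le> K"
proof -
  define h where "h x = (\<Sum>\<beta>\<in>UNIV. \<Sum>i\<in>UNIV. bnd \<beta> i x)" for x
  have nn: "bnd \<beta> i x \<ge> 0" for \<beta> i x
    unfolding bnd_def by (intro sum_nonneg mult_nonneg_nonneg) auto
  have "continuous_on C h"
    unfolding h_def bnd_def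
    by (intro continuous_intros continuous_on_subset[OF continuous_on_christoffel assms(2)]
        continuous_on_subset[OF smooth_on_continuous_on[OF smooth_a] assms(2)]
        continuous_on_subset[OF smooth_on_continuous_on[OF smooth_b] assms(2)])
  then have "bounded (h ` C)"
    using assms(1) by (intro compact_imp_bounded compact_continuous_image)
  then obtain K where K: "\<And>x. x \<in> C \<Longrightarrow> norm (h x) \<le> K"
    by (auto simp: bounded_iff)
  show ?thesis
  proof (rule that[of "\<bar>K\<bar>"])
    fix x \<beta> i assume x: "x \<in> C"
    have "bnd \<beta> i x \<le> (\<Sum>i\<in>UNIV. bnd \<beta> i x)"
      by (rule member_le_sum) (auto simp: nn)
    also have "\<dots> \<le> h x"
      unfolding h_def by (rule member_le_sum[where f = "\<lambda>\<beta>. \<Sum>i\<in>UNIV. bnd \<beta> i x"]) (auto intro!: sum_nonneg nn)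
    also have "\<dots> \<le> \<bar>K\<bar>" using K[OF x] by simp
    finally show "bnd \<beta> i x \<le> \<bar>K\<bar>" .
  qed simp
qed

text \<open>The equation for \<open>b \<beta> i\<close> involves only components of \<open>b\<close>
  with the same \<open>\<beta>\<close>, and that for \<open>a \<gamma> i\<close> only components of
  \<open>a\<close> with the same \<open>\<gamma>\<close>. For each fixed index the vector
  \<open>\<Phi>\<close> thus solves a closed system; \<open>b\<close> is conjugated to turn its
  \<open>dz\<close>-equation into a \<open>dzbar\<close>-equation. The closed ball provides the
  compactness for a uniform bound \<open>K\<close>.\<close>

lemma linear_unique_continuation:
  assumes \<sigma>: "\<sigma> = (\<lambda>c. c) \<or> \<sigma> = cnj"
    and ball: "cball p R \<subseteq> S" and r: "r > 0" "ball p r \<subseteq> S"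
    and lin: "\<And>x. x \<in> ball p r \<Longrightarrow> linear_over \<sigma> (frechet_derivative F (at x))"
    and q: "q \<in> ball p R"
  shows "linear_over \<sigma> (frechet_derivative F (at q))"
proof -
  obtain K where K: "K \<ge> 0" "\<And>x \<beta> i. x \<in> cball p R \<Longrightarrow> bnd \<beta> i x \<le> K"
    using bnd_bounded[OF compact_cball ball] by blast
  have bS: "ball p R \<subseteq> S" using ball by auto
  have smb: "smooth_on u (ball p R)" if "smooth_on u S" for u :: "complex^'m \<Rightarrow> 'c::real_normed_vector"
    using that Ck_on_subset[OF _ bS] by (auto simp: smooth_on_def)
  have est: "norm (\<Sum>j\<in>UNIV. \<Sum>k\<in>UNIV. christoffel g d (F x) i j k * u j * v k) \<le> K * N"
    if x: "x \<in> ball p R" and N: "N \<ge> 0"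
      and uv: "\<And>j k. norm (u j * v k) \<le> (norm (a \<beta> k x) + norm (b \<beta> j x)) * N" for x \<beta> i u v N
  proof -
    have "norm (\<Sum>j\<in>UNIV. \<Sum>k\<in>UNIV. christoffel g d (F x) i j k * u j * v k)
       \<le> (\<Sum>j\<in>UNIV. \<Sum>k\<in>UNIV. norm (christoffel g d (F x) i j k) * ((norm (a \<beta> k x) + norm (b \<beta> j x)) * N))"
      unfolding mult.assoc
      by (intro sum_norm_le) (unfold norm_mult[of "christoffel _ _ _ _ _ _"], intro mult_left_mono uv norm_ge_zero)
    also have "\<dots> = bnd \<beta> i x * N"
      by (simp add: bnd_def sum_distrib_right mult.assoc)
    also have "\<dots> \<le> K * N"
    proof (rule mult_right_mono)
      show "bnd \<beta> i x \<le> K" using K(2) x by auto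
    qed (rule N)
    finally show ?thesis .
  qed
  have qS: "q \<in> S" using q bS by blast
  show ?thesis
    using \<sigma>
  proof
    assume \<sigma>: "\<sigma> = (\<lambda>c. c)"
    have "b \<beta> i q = 0" for \<beta> i
    proof -
      define \<Phi> where "\<Phi> x = (\<chi> i. cnj (b \<beta> i x))" for x
      have "\<Phi> q = 0"
      proof (rule ball_unique_continuation[OF _ K(1) _ r(1) _ q])
        show "smooth_on \<Phi> (ball p R)"
          unfolding \<Phi>_def
          by (intro smb smooth_on_vec_lambda S smooth_on_bounded_linear[OF S bounded_linear_cnj] smooth_b)
        show "\<Phi> z = 0" if "z \<in> ball p r" for z
        proof -
          have "z \<in> S" using that r by blast
          then show ?thesis
            using lin[OF that] \<sigma> linear_over_id_iff by (simp add: \<Phi>_def vec_eq_iff)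
        qed
        fix z \<alpha> i assume z: "z \<in> ball p R"
        then have zS: "z \<in> S" using bS by blast
        have "dzbar \<alpha> (\<lambda>x. \<Phi> x $ i) z = cnj (dz \<alpha> (b \<beta> i) z)"
          using dzbar_cnj[OF smooth_on_differentiable[OF smooth_b zS]] by (simp add: \<Phi>_def)
        then have "norm (dzbar \<alpha> (\<lambda>x. \<Phi> x $ i) z) =
          norm (\<Sum>j\<in>UNIV. \<Sum>k\<in>UNIV. christoffel g d (F z) i j k * b \<beta> j z * a \<alpha> k z)"
          unfolding dz_b[OF zS] by (simp only: complex_mod_cnj norm_minus_cancel)
        also have "\<dots> \<le> K * norm (\<Phi> z)"
        proof (rule est[OF z norm_ge_zero])
          fix j k
          have "norm (b \<beta> j z) \<le> norm (\<Phi> z)"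
            using Finite_Cartesian_Product.norm_nth_le[of "\<Phi> z" j] by (simp add: \<Phi>_def)
          then have "norm (a \<alpha> k z) * norm (b \<beta> j z) \<le> (norm (a \<alpha> k z) + norm (b \<alpha> j z)) * norm (\<Phi> z)"
            by (intro mult_mono) auto
          then show "norm (b \<beta> j z * a \<alpha> k z) \<le> (norm (a \<alpha> k z) + norm (b \<alpha> j z)) * norm (\<Phi> z)"
            by (simp add: norm_mult mult.commute)
        qed
        finally show "norm (dzbar \<alpha> (\<lambda>x. \<Phi> x $ i) z) \<le> K * norm (\<Phi> z)" .
      qed
      then show ?thesis by (simp add: \<Phi>_def vec_eq_iff)
    qed
    then show ?thesis using \<sigma> qS by (simp add: linear_over_id_iff)
  next
    assume \<sigma>: "\<sigma> = cnj"
    have "a \<gamma> i q = 0" for \<gamma> i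
    proof -
      define \<Phi> where "\<Phi> x = (\<chi> i. a \<gamma> i x)" for x
      have "\<Phi> q = 0"
      proof (rule ball_unique_continuation[OF _ K(1) _ r(1) _ q])
        show "smooth_on \<Phi> (ball p R)"
          unfolding \<Phi>_def by (intro smb smooth_on_vec_lambda S smooth_a)
        show "\<Phi> z = 0" if "z \<in> ball p r" for z
        proof -
          have "z \<in> S" using that r by blast
          then show ?thesis
            using lin[OF that] \<sigma> linear_over_cnj_iff by (simp add: \<Phi>_def vec_eq_iff)
        qed
        fix z \<beta> i assume z: "z \<in> ball p R"
        then have zS: "z \<in> S" using bS by blast
        have "norm (dzbar \<beta> (\<lambda>x. \<Phi> x $ i) z) =
          norm (\<Sum>j\<in>UNIV. \<Sum>k\<in>UNIV. christoffel g d (F z) i j k * b \<beta> j z * a \<gamma> k z)"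
          by (simp add: \<Phi>_def dzbar_a[OF zS])
        also have "\<dots> \<le> K * norm (\<Phi> z)"
        proof (rule est[OF z norm_ge_zero])
          fix j k
          have "norm (a \<gamma> k z) \<le> norm (\<Phi> z)"
            using Finite_Cartesian_Product.norm_nth_le[of "\<Phi> z" k] by (simp add: \<Phi>_def)
          then have "norm (b \<beta> j z) * norm (a \<gamma> k z) \<le> (norm (a \<beta> k z) + norm (b \<beta> j z)) * norm (\<Phi> z)"
            by (intro mult_mono) auto
          then show "norm (b \<beta> j z * a \<gamma> k z) \<le> (norm (a \<beta> k z) + norm (b \<beta> j z)) * norm (\<Phi> z)"
            by (simp add: norm_mult)
        qed
        finally show "norm (dzbar \<beta> (\<lambda>x. \<Phi> x $ i) z) \<le> K * norm (\<Phi> z)" .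
      qed
      then show ?thesis by (simp add: \<Phi>_def vec_eq_iff)
    qed
    then show ?thesis using \<sigma> qS by (simp add: linear_over_cnj_iff)
  qed
qed

end

section \<open>Charts\<close>

lemma complex_manifoldD:
  assumes "complex_manifold \<A>"
  shows "connected (UNIV :: 'a::{t2_space,second_countable_topology} set)"
    and "\<And>c. c \<in> \<A> \<Longrightarrow> is_chart (c :: ('a, 'm::finite) chart)"
    and "\<And>x. \<exists>c\<in>\<A>. x \<in> cdom c"
    and "\<And>c d. c \<in> \<A> \<Longrightarrow> d \<in> \<A> \<Longrightarrow> hol_on (transition c d) (coord c ` (cdom c \<inter> cdom d))"
  using assms by (auto simp: complex_manifold_def set_eq_iff)

lemma param_coord:
  assumes "is_chart c" "x \<in> cdom c"
  shows "param c (coord c x) = x"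
proof -
  have "homeomorphism (cdom c) (coord c ` cdom c) (coord c) (param c)"
    using assms(1) by (simp add: is_chart_def)
  then show ?thesis by (rule homeomorphism_apply1) (rule assms(2))
qed

lemma open_coord_image:
  assumes "is_chart c" "open U"
  shows "open (coord c ` (cdom c \<inter> U))"
proof -
  have h: "homeomorphism (cdom c) (coord c ` cdom c) (coord c) (param c)"
    and o: "open (cdom c)" "open (coord c ` cdom c)"
    using assms(1) by (auto simp: is_chart_def)
  have "openin (top_of_set (cdom c)) (cdom c \<inter> U)"
    using assms(2) by (auto simp: openin_open)
  then have "openin (top_of_set (coord c ` cdom c)) (coord c ` (cdom c \<inter> U))"
    by (rule homeomorphism_imp_open_map[OF h])
  then show ?thesis using o(2) by (simp add: openin_open_eq)
qed

lemma open_coord_vimage: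
  assumes "is_chart c" "open V"
  shows "open (cdom c \<inter> coord c -` V)"
  using assms by (intro continuous_open_preimage) (auto simp: is_chart_def homeomorphism_def)

section \<open>Passage from charts to the connected source manifold\<close>

locale manifold_map =
  fixes \<A> :: "('a::{t2_space,second_countable_topology}, 'm::finite) chart set"
    and \<B> :: "('b::{t2_space,second_countable_topology}, 'n::finite) chart set"
    and g :: "('b, 'n) metric" and f :: "'a \<Rightarrow> 'b"
  assumes \<A>: "complex_manifold \<A>" and \<B>: "complex_manifold \<B>"
    and kaehler: "kaehler_metric \<B> g" and pluriharmonic: "pluriharmonic_map \<A> \<B> g f"
    and negative: "strongly_negative_curvature \<B> g"
begin

lemma continuous_f: "continuous_on UNIV f"
  using pluriharmonic by (simp add: pluriharmonic_map_def smooth_map_def)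

lemma open_vimage_f: "open U \<Longrightarrow> open (f -` U)"
  using continuous_f by (simp add: continuous_on_open_vimage)

lemma open_cdom: "c \<in> \<A> \<Longrightarrow> open (cdom c)" "d \<in> \<B> \<Longrightarrow> open (cdom d)"
  using complex_manifoldD(2)[OF \<A>] complex_manifoldD(2)[OF \<B>] by (auto simp: is_chart_def)

lemma chart: "c \<in> \<A> \<Longrightarrow> is_chart c" "d \<in> \<B> \<Longrightarrow> is_chart d"
  using complex_manifoldD(2)[OF \<A>] complex_manifoldD(2)[OF \<B>] by auto

text \<open>\<open>local_dom\<close> is an image, so membership determines the point only through
  injectivity of the chart.\<close>

lemma coord_in_local_dom_iff:
  assumes "c \<in> \<A>" "x \<in> cdom c"
  shows "coord c x \<in> local_dom c d f \<longleftrightarrow> f x \<in> cdom d"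
proof
  assume "coord c x \<in> local_dom c d f"
  then obtain u where "u \<in> cdom c" "f u \<in> cdom d" "coord c x = coord c u"
    by (auto simp: local_dom_def)
  then show "f x \<in> cdom d"
    using param_coord[OF chart(1)[OF assms(1)]] assms(2) by metis
qed (use assms in \<open>auto simp: local_dom_def\<close>)

lemma local_pluriharmonic:
  assumes c: "c \<in> \<A>" and d: "d \<in> \<B>"
  shows "local_pluriharmonic (local_dom c d f) (coord d ` cdom d) (local_rep c d f) g d"
proof
  show "open (local_dom c d f)"
    unfolding local_dom_def by (intro open_coord_image chart c open_vimage_f open_cdom(2) d)
  show "open (coord d ` cdom d)"
    using chart(2)[OF d] by (simp add: is_chart_def)
  show "smooth_on (local_rep c d f) (local_dom c d f)"
    using pluriharmonic c d by (auto simp: pluriharmonic_map_def smooth_map_def)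
  show "local_rep c d f z \<in> coord d ` cdom d" if "z \<in> local_dom c d f" for z
    using that param_coord[OF chart(1)[OF c]] by (auto simp: local_dom_def local_rep_def)
  show "smooth_on (g d) (coord d ` cdom d)"
    "w \<in> coord d ` cdom d \<Longrightarrow> v \<noteq> 0 \<Longrightarrow> 0 < Re (herm (g d w) v v)" for w v
    using kaehler d unfolding kaehler_metric_def hermitian_metric_def by blast+
qed (use pluriharmonic negative c d in \<open>auto simp: pluriharmonic_map_def strongly_negative_curvature_def\<close>)

definition linear_in :: "(complex \<Rightarrow> complex) \<Rightarrow> ('a, 'm) chart \<Rightarrow> ('b, 'n) chart \<Rightarrow> 'a \<Rightarrow> bool" where
  "linear_in \<sigma> c d x \<longleftrightarrow> linear_over \<sigma> (frechet_derivative (local_rep c d f) (at (coord c x)))"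

definition linear_at :: "(complex \<Rightarrow> complex) \<Rightarrow> 'a \<Rightarrow> bool" where
  "linear_at \<sigma> x \<longleftrightarrow> (\<forall>c\<in>\<A>. \<forall>d\<in>\<B>. x \<in> cdom c \<longrightarrow> f x \<in> cdom d \<longrightarrow> linear_in \<sigma> c d x)"

text \<open>Transition maps have complex linear derivatives \<open>T1\<close>, \<open>T2\<close>,
  and composing with them on either side preserves linearity over any \<open>\<sigma>\<close>. One
  pair of charts therefore suffices at each point.\<close>

lemma linear_in_imp_linear_at:
  assumes c: "c \<in> \<A>" "x \<in> cdom c" and d: "d \<in> \<B>" "f x \<in> cdom d" and lin: "linear_in \<sigma> c d x"
  shows "linear_at \<sigma> x"
  unfolding linear_at_def
proof (intro ballI impI)
  fix c' d' assume c': "c' \<in> \<A>" and d': "d' \<in> \<B>" and x: "x \<in> cdom c'" "f x \<in> cdom d'"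
  note pc = param_coord[OF chart(1)] and pd = param_coord[OF chart(2)]
  interpret local_pluriharmonic "local_dom c d f" "coord d ` cdom d" "local_rep c d f" g d
    by (rule local_pluriharmonic[OF c(1) d(1)])
  let ?y = "coord c' x"
  \<comment> \<open>The open set on which the new local representation is the old one composed with
    both transitions.\<close>
  let ?N = "coord c' ` (cdom c' \<inter> (cdom c \<inter> f -` (cdom d \<inter> cdom d')))"
  have N: "open ?N"
    by (intro open_coord_image chart c' open_Int open_cdom open_vimage_f c d d')
  have yN: "?y \<in> ?N" using x c d by blast
  have tc: "transition c' c ?y = coord c x" using pc[OF c' x(1)] by (simp add: transition_def)
  obtain T1 where T1: "(transition c' c has_derivative T1) (at ?y)" "\<And>a v. T1 (a *s v) = a *s T1 v"
    using complex_manifoldD(4)[OF \<A> c' c(1)] x c unfolding hol_on_def by blast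
  obtain T2 where T2: "(transition d d' has_derivative T2) (at (coord d (f x)))" "\<And>a v. T2 (a *s v) = a *s T2 v"
    using complex_manifoldD(4)[OF \<B> d(1) d'] x d unfolding hol_on_def by blast
  let ?D = "frechet_derivative (local_rep c d f) (at (coord c x))"
  have xd: "coord c x \<in> local_dom c d f"
    using c d by (auto simp: local_dom_def)
  have "((\<lambda>z. local_rep c d f (transition c' c z)) has_derivative (\<lambda>v. ?D (T1 v))) (at ?y)"
    using has_derivative_compose[OF T1(1), of "local_rep c d f" ?D] F_derivative[OF xd] by (simp add: tc)
  moreover have "local_rep c d f (transition c' c ?y) = coord d (f x)"
    using pc[OF c(1,2)] by (simp add: tc local_rep_def)
  ultimately have "((\<lambda>z. transition d d' (local_rep c d f (transition c' c z))) has_derivative (\<lambda>v. T2 (?D (T1 v)))) (at ?y)"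
    using has_derivative_compose[of "\<lambda>z. local_rep c d f (transition c' c z)" _ ?y UNIV "transition d d'" T2] T2(1)
    by simp
  then have "(local_rep c' d' f has_derivative (\<lambda>v. T2 (?D (T1 v)))) (at ?y)"
    by (rule has_derivative_transform_within_open[OF _ N yN])
       (auto simp: transition_def local_rep_def pc[OF c'] pc[OF c(1)] pd[OF d(1)])
  then have "frechet_derivative (local_rep c' d' f) (at ?y) = (\<lambda>v. T2 (?D (T1 v)))"
    by (rule frechet_derivative_at[symmetric])
  then show "linear_in \<sigma> c' d' x"
    using lin T1(2) T2(2) by (simp add: linear_in_def linear_over_def)
qed

lemma charts_at:
  obtains c d where "c \<in> \<A>" "x \<in> cdom c" "d \<in> \<B>" "f x \<in> cdom d"
  using complex_manifoldD(3)[OF \<A>, of x] complex_manifoldD(3)[OF \<B>, of "f x"] by blast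

lemma linear_at_ball:
  assumes c: "c \<in> \<A>" and d: "d \<in> \<B>" and S: "ball p r \<subseteq> local_dom c d f"
    and lin: "\<And>z. z \<in> ball p r \<Longrightarrow> linear_over \<sigma> (frechet_derivative (local_rep c d f) (at z))"
  shows "open (cdom c \<inter> coord c -` ball p r)" "cdom c \<inter> coord c -` ball p r \<subseteq> {x. linear_at \<sigma> x}"
proof -
  show "open (cdom c \<inter> coord c -` ball p r)"
    by (intro open_coord_vimage chart c) simp
  show "cdom c \<inter> coord c -` ball p r \<subseteq> {x. linear_at \<sigma> x}"
  proof safe
    fix x assume x: "x \<in> cdom c" "coord c x \<in> ball p r"
    then have "coord c x \<in> local_dom c d f" using S by blast
    then have "f x \<in> cdom d"
      using coord_in_local_dom_iff[OF c x(1)] by blast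
    then show "linear_at \<sigma> x"
      using linear_in_imp_linear_at[OF c x(1) d] lin[OF x(2)] by (simp add: linear_in_def)
  qed
qed

text \<open>Unique continuation starts from an open set, so the clopen argument is run with the
  interior of the good set: it is open by definition, and continuation on coordinate balls makes it
  closed.\<close>

lemma linear_everywhere:
  assumes \<sigma>: "\<sigma> = (\<lambda>c. c) \<or> \<sigma> = cnj" and ne: "interior {x. linear_at \<sigma> x} \<noteq> {}"
  shows "linear_at \<sigma> x"
proof -
  define Z where "Z = interior {x. linear_at \<sigma> x}"
  have Zo: "open Z" by (simp add: Z_def)
  have "closure Z \<subseteq> Z"
  proof
    fix x assume x: "x \<in> closure Z"
    obtain c d where c: "c \<in> \<A>" "x \<in> cdom c" and d: "d \<in> \<B>" "f x \<in> cdom d"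
      by (rule charts_at)
    interpret local_pluriharmonic "local_dom c d f" "coord d ` cdom d" "local_rep c d f" g d
      by (rule local_pluriharmonic[OF c(1) d(1)])
    let ?p = "coord c x"
    have "?p \<in> local_dom c d f" using c d by (auto simp: local_dom_def)
    then obtain R where R: "R > 0" "cball ?p R \<subseteq> local_dom c d f"
      using S open_contains_cball by blast
    \<comment> \<open>Continuation has to be centred at a good point \<open>?q\<close>, not at
      \<open>?p\<close>. With \<open>?q\<close> within \<open>R / 3\<close> of \<open>?p\<close>,
      the ball of radius \<open>2 * R / 3\<close> about \<open>?q\<close> covers the
      \<open>R / 3\<close>-ball about \<open>?p\<close> and stays in the ball of radius
      \<open>R\<close>.\<close>
    let ?V = "cdom c \<inter> coord c -` ball ?p (R / 3)"
    have "open ?V" "x \<in> ?V"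
      using c R by (auto intro!: open_coord_vimage chart)
    then obtain y where y: "y \<in> ?V" "y \<in> Z"
      using x by (meson disjoint_iff open_Int_closure_eq_empty)
    let ?q = "coord c y"
    \<comment> \<open>Intersecting with the preimage of \<open>cdom d\<close> lets
      \<open>linear_at\<close> be read in the fixed pair \<open>c\<close>, \<open>d\<close>.\<close>
    let ?W = "coord c ` (cdom c \<inter> (Z \<inter> f -` cdom d))"
    have "?q \<in> cball ?p R" using y R by auto
    then have "?q \<in> local_dom c d f" using R by blast
    then have "f y \<in> cdom d"
      using coord_in_local_dom_iff[OF c(1)] y(1) by blast
    then have "?q \<in> ?W" using y by blast
    moreover have "open ?W"
      by (intro open_coord_image chart c open_Int Zo open_vimage_f open_cdom d)
    ultimately obtain r where r: "r > 0" "ball ?q r \<subseteq> ?W"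
      using openE by blast
    have sub: "ball ?p (R / 3) \<subseteq> ball ?q (2 * R / 3)" "cball ?q (2 * R / 3) \<subseteq> cball ?p R"
    proof -
      have pq: "dist ?p ?q < R / 3" using y by simp
      show "ball ?p (R / 3) \<subseteq> ball ?q (2 * R / 3)"
      proof
        fix z assume "z \<in> ball ?p (R / 3)"
        then show "z \<in> ball ?q (2 * R / 3)"
          using pq dist_triangle[of ?q z ?p] by (simp add: dist_commute)
      qed
      show "cball ?q (2 * R / 3) \<subseteq> cball ?p R"
      proof
        fix z assume "z \<in> cball ?q (2 * R / 3)"
        then show "z \<in> cball ?p R"
          using pq dist_triangle[of ?p z ?q] by simp
      qed
    qed
    have lin: "linear_over \<sigma> (frechet_derivative (local_rep c d f) (at z))" if "z \<in> ball ?p (R / 3)" for z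
    proof (rule linear_unique_continuation[OF \<sigma> _ r(1)])
      show "cball ?q (2 * R / 3) \<subseteq> local_dom c d f" using sub R by blast
      show "ball ?q r \<subseteq> local_dom c d f" using r by (auto simp: local_dom_def)
      show "z \<in> ball ?q (2 * R / 3)" using sub that by blast
      fix z assume "z \<in> ball ?q r"
      then obtain u where u: "z = coord c u" "u \<in> cdom c" "u \<in> Z" "f u \<in> cdom d" using r by blast
      then have "linear_at \<sigma> u" using interior_subset by (auto simp: Z_def)
      then show "linear_over \<sigma> (frechet_derivative (local_rep c d f) (at z))"
        using u c d by (simp add: linear_at_def linear_in_def)
    qed
    have "ball ?p (R / 3) \<subseteq> local_dom c d f" using sub R by (meson ball_subset_cball subset_trans)
    from linear_at_ball[OF c(1) d(1) this lin] have "?V \<subseteq> Z"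
      unfolding Z_def by (intro interior_maximal)
    then show "x \<in> Z" using \<open>x \<in> ?V\<close> by blast
  qed
  then have "closed Z" by (simp add: closure_subset_eq)
  with Zo ne complex_manifoldD(1)[OF \<A>] have "Z = UNIV"
    unfolding connected_clopen Z_def by auto
  then show ?thesis using interior_subset by (auto simp: Z_def)
qed

lemma linear_at_imp_derivative:
  assumes "\<And>x. linear_at \<sigma> x" "c \<in> \<A>" "d \<in> \<B>" "z \<in> local_dom c d f"
  shows "\<exists>D. (local_rep c d f has_derivative D) (at z) \<and> (\<forall>c v. D (c *s v) = \<sigma> c *s D v)"
proof -
  interpret local_pluriharmonic "local_dom c d f" "coord d ` cdom d" "local_rep c d f" g d
    by (rule local_pluriharmonic[OF assms(2,3)])
  obtain x where "x \<in> cdom c" "f x \<in> cdom d" "z = coord c x"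
    using assms(4) by (auto simp: local_dom_def)
  then show ?thesis
    using F_derivative[OF assms(4)] assms(1)[of x] assms(2,3)
    by (auto simp: linear_at_def linear_in_def linear_over_def)
qed

text \<open>\<open>Max\<close> returns an element only for a finite nonempty set: ranks are bounded
  by the real dimension of the target, and some pair of charts exists at any point.\<close>

lemma max_real_rank_attained:
  obtains c d z where "c \<in> \<A>" "d \<in> \<B>" "z \<in> local_dom c d f"
    "max_real_rank \<A> \<B> f = dim (range (frechet_derivative (local_rep c d f) (at z)))"
proof -
  let ?R = "{dim (range (frechet_derivative (local_rep c d f) (at z))) | c d z.
            c \<in> \<A> \<and> d \<in> \<B> \<and> z \<in> local_dom c d f}"
  have "?R \<subseteq> {..DIM(complex^'n)}"
    using dim_subset_UNIV unfolding subset_iff atMost_iff by blast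
  then have "finite ?R" by (rule finite_subset) simp
  moreover have "?R \<noteq> {}"
  proof -
    \<comment> \<open>\<open>undefined\<close> stands for an arbitrary point of the source.\<close>
    obtain c d where "c \<in> \<A>" "undefined \<in> cdom c" "d \<in> \<B>" "f undefined \<in> cdom d"
      by (rule charts_at)
    then have "coord c undefined \<in> local_dom c d f"
      by (simp add: coord_in_local_dom_iff)
    with \<open>c \<in> \<A>\<close> \<open>d \<in> \<B>\<close> show ?thesis by blast
  qed
  ultimately have "Max ?R \<in> ?R" by (rule Max_in)
  then show ?thesis using that unfolding max_real_rank_def by blast
qed

end

theorem corollary1p5:
  fixes \<A> :: "('a::{t2_space,second_countable_topology}, 'm::finite) chart set"
    and \<B> :: "('b::{t2_space,second_countable_topology}, 'n::finite) chart set"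
    and g :: "('b, 'n) metric"
    and f :: "'a \<Rightarrow> 'b"
  assumes "complex_manifold \<A>" and "compact (UNIV :: 'a set)"
    and "complex_manifold \<B>" and "compact (UNIV :: 'b set)"
    and "kaehler_metric \<B> g"
    and "pluriharmonic_map \<A> \<B> g f"
    and "strongly_negative_curvature \<B> g"
    and "max_real_rank \<A> \<B> f \<ge> 4"
  shows "holomorphic_map \<A> \<B> f \<or> antiholomorphic_map \<A> \<B> f"
proof -
  interpret manifold_map \<A> \<B> g f
    by unfold_locales (use assms in auto)
  obtain c d z where c: "c \<in> \<A>" and d: "d \<in> \<B>" and z: "z \<in> local_dom c d f"
    and rank: "dim (range (frechet_derivative (local_rep c d f) (at z))) \<ge> 3"
  proof (rule max_real_rank_attained)
    fix c d z
    assume "c \<in> \<A>" "d \<in> \<B>" "z \<in> local_dom c d f"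
      "max_real_rank \<A> \<B> f = dim (range (frechet_derivative (local_rep c d f) (at z)))"
    with assms(8) show ?thesis by (intro that[of c d z]) auto
  qed
  interpret local_pluriharmonic "local_dom c d f" "coord d ` cdom d" "local_rep c d f" g d
    by (rule local_pluriharmonic[OF c d])
  obtain r \<sigma> where r0: "r > 0" and \<sigma>: "\<sigma> = (\<lambda>c. c) \<or> \<sigma> = cnj" and r: "ball z r \<subseteq> local_dom c d f"
    and lin: "\<And>x. x \<in> ball z r \<Longrightarrow> linear_over \<sigma> (frechet_derivative (local_rep c d f) (at x))"
  proof (rule rank_ge_3_imp_linear_near[OF z rank])
    fix r \<sigma>
    assume "r > 0" "\<sigma> = (\<lambda>c. c) \<or> \<sigma> = cnj" "ball z r \<subseteq> local_dom c d f"
      "\<And>x. x \<in> ball z r \<Longrightarrow> linear_over \<sigma> (frechet_derivative (local_rep c d f) (at x))"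
    then show ?thesis by (rule that)
  qed
  obtain x where "x \<in> cdom c" "coord c x = z"
    using z by (auto simp: local_dom_def)
  then have "x \<in> interior {x. linear_at \<sigma> x}"
    using subsetD[OF interior_maximal[OF linear_at_ball(2,1)[OF c d r lin]]] r0 by simp
  then have "linear_at \<sigma> y" for y
    using linear_everywhere[OF \<sigma>] by blast
  note D = linear_at_imp_derivative[OF this]
  from \<sigma> show ?thesis
  proof
    assume \<sigma>: "\<sigma> = (\<lambda>c. c)"
    have "hol_on (local_rep c d f) (local_dom c d f)" if "c \<in> \<A>" "d \<in> \<B>" for c d
      using D[OF that] unfolding hol_on_def \<sigma> by simp
    then show ?thesis
      using continuous_f by (simp add: holomorphic_map_def)
  next
    assume \<sigma>: "\<sigma> = cnj"
    have "antihol_on (local_rep c d f) (local_dom c d f)" if "c \<in> \<A>" "d \<in> \<B>" for c d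
      using D[OF that] unfolding antihol_on_def \<sigma> by simp
    then show ?thesis
      using continuous_f by (simp add: antiholomorphic_map_def)
  qed
qed

end
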